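(* Let $g:\mathbb{R}^d\to\mathbb{R}_+$ be convex with $g(0)=0$ and $\limsup_{|z|\to\infty} g(z)/|z|^2=\infty$, and assume that its Fenchel–Legendre transform $f$ is finite. Then there exist random variables $\xi_k\in L^\infty(\mathcal{F}_T)$, $k\ge1$, and $\xi\in L^\infty(\mathcal{F}_T)$ with $\xi_k\to\xi$ in $L^\infty$, and a sequence $(Y^k)_{k\ge 1}$, where $Y^k$ is a bounded solution of the BSDE $dY_t=g(Z_t)\,dt-Z_t\,dB_t$ with terminal value $Y_T=\xi_k$, such that $(Y^k)_{k\ge1}$ is nondecreasing in $k$, uniformly bounded, and converges to a process $Y$ which is not a solution of the BSDE $dY_t=g(Z_t)\,dt-Z_t\,dB_t$, $Y_T=\xi$.
   Context: Fix $T>0$ and an integer $d\ge 1$. $B=(B_t)_{0\le t\le T}$ is a $d$-dimensional standard Brownian motion on a probability space $(\Omega,\mathcal{F},P)$, and $(\mathcal{F}_t)_{0\le t\le T}$ is its natural filtration augmented by all $P$-null sets. $L^\infty(\mathcal{F}_T)$ is the set of bounded $\mathcal{F}_T$-measurable real random variables (identified when $P$-a.s. equal). The Fenchel–Legendre transform of $g$ is $f(x)=\sup_{z\in\mathbb{R}^d}(z\cdot x-g(z))$. For $\xi\in L^\infty(\mathcal{F}_T)$, a bounded solution of the BSDE $dY_t=g(Z_t)\,dt-Z_t\,dB_t$, $Y_T=\xi$, is a pair of predictable processes $(Y,Z)$ such that $Y:\Omega\times[0,T]\to\mathbb{R}$ is bounded, $Z:\Omega\times[0,T]\to\mathbb{R}^d$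 (row vector) is $B$-integrable with $E[\int_0^T g(Z_t)\,dt]<\infty$, and $Y_t=\xi-\int_t^T g(Z_s)\,ds+\int_t^T Z_s\,dB_s$ for all $t\in[0,T]$, $P$-a.s. A bounded process $Y$ alone is called a solution if such a $Z$ exists. *)

theory Defs
  imports "HOL-Probability.Probability"
begin

text \<open>Processes are curried, time first: \<open>X t \<omega>\<close>. Only times in \<open>{0..T}\<close> matter.\<close>

section \<open>Brownian motion and its filtration\<close>

definition standard_brownian_motion ::
    "'w measure \<Rightarrow> real \<Rightarrow> (real \<Rightarrow> 'w \<Rightarrow> real ^ 'd) \<Rightarrow> bool" where
  "standard_brownian_motion M T B \<longleftrightarrow>
     (\<forall>t\<in>{0..T}. B t \<in> borel_measurable M) \<and>
     (AE \<omega> in M. B 0 \<omega> = 0) \<and>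
     (AE \<omega> in M. continuous_on {0..T} (\<lambda>t. B t \<omega>)) \<and>
     (\<forall>s t. 0 \<le> s \<and> s < t \<and> t \<le> T \<longrightarrow>
        distributed M lborel (\<lambda>\<omega>. B t \<omega> - B s \<omega>)
          (\<lambda>x. ennreal (\<Prod>i\<in>UNIV. normal_density 0 (sqrt (t - s)) (x $ i)))) \<and>
     (\<forall>(n::nat) \<tau>. 0 \<le> \<tau> 0 \<and> \<tau> n \<le> T \<and> (\<forall>i<n. \<tau> i < \<tau> (Suc i)) \<longrightarrow>
        prob_space.indep_vars M (\<lambda>_. borel) (\<lambda>i \<omega>. B (\<tau> (Suc i)) \<omega> - B (\<tau> i) \<omega>) {..<n})"

text \<open>If \<open>M\<close> is not complete, only the null sets belonging to \<open>sets M\<close> are adjoined;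
  the usual augmentation is recovered by taking \<open>M\<close> complete.\<close>

definition brownian_filtration ::
    "'w measure \<Rightarrow> (real \<Rightarrow> 'w \<Rightarrow> real ^ 'd) \<Rightarrow> real \<Rightarrow> 'w measure" where
  "brownian_filtration M B t =
     sigma (space M)
       ({B s -` A \<inter> space M |s A. s \<in> {0..t} \<and> A \<in> sets borel} \<union> null_sets M)"

definition predictable_sigma ::
    "'w measure \<Rightarrow> real \<Rightarrow> (real \<Rightarrow> 'w measure) \<Rightarrow> (real \<times> 'w) measure" where
  "predictable_sigma M T F =
     sigma ({0..T} \<times> space M)
       ({{0} \<times> A |A. A \<in> sets (F 0)} \<union>
        {{s<..t} \<times> A |s t A. 0 \<le> s \<and> s < t \<and> t \<le> T \<and> A \<in> sets (F s)})"

definition predictable ::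
    "'w measure \<Rightarrow> real \<Rightarrow> (real \<Rightarrow> 'w measure) \<Rightarrow>
     (real \<Rightarrow> 'w \<Rightarrow> 'b::topological_space) \<Rightarrow> bool" where
  "predictable M T F X \<longleftrightarrow> (\<lambda>(t, \<omega>). X t \<omega>) \<in> borel_measurable (predictable_sigma M T F)"

definition Linf :: "'w measure \<Rightarrow> ('w \<Rightarrow> real) set" where
  "Linf N = {\<xi> \<in> borel_measurable N. bounded (\<xi> ` space N)}"

definition bounded_process :: "'w measure \<Rightarrow> real \<Rightarrow> (real \<Rightarrow> 'w \<Rightarrow> real) \<Rightarrow> bool" where
  "bounded_process M T Y \<longleftrightarrow> (\<exists>C. \<forall>t\<in>{0..T}. \<forall>\<omega>\<in>space M. \<bar>Y t \<omega>\<bar> \<le> C)"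

section \<open>The Ito integral\<close>

text \<open>The triple \<open>n\<close>, \<open>\<tau>\<close>, \<open>\<phi>\<close> encodes the simple process
  \<open>\<Sum>i<n. indicator {\<tau> i<..\<tau> (i+1)} t * \<phi> i\<close>.\<close>

definition simple_integrand ::
    "'w measure \<Rightarrow> real \<Rightarrow> (real \<Rightarrow> 'w measure) \<Rightarrow>
     nat \<Rightarrow> (nat \<Rightarrow> real) \<Rightarrow> (nat \<Rightarrow> 'w \<Rightarrow> real ^ 'd) \<Rightarrow> bool" where
  "simple_integrand M T F n \<tau> \<phi> \<longleftrightarrow>
     0 \<le> \<tau> 0 \<and> \<tau> n \<le> T \<and> (\<forall>i<n. \<tau> i < \<tau> (Suc i)) \<and>
     (\<forall>i<n. \<phi> i \<in> borel_measurable (F (\<tau> i)) \<and> bounded (\<phi> i ` space M))"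

definition simple_process ::
    "nat \<Rightarrow> (nat \<Rightarrow> real) \<Rightarrow> (nat \<Rightarrow> 'w \<Rightarrow> real ^ 'd) \<Rightarrow> real \<Rightarrow> 'w \<Rightarrow> real ^ 'd" where
  "simple_process n \<tau> \<phi> t \<omega> = (\<Sum>i<n. indicator {\<tau> i<..\<tau> (Suc i)} t *\<^sub>R \<phi> i \<omega>)"

definition simple_integral ::
    "(real \<Rightarrow> 'w \<Rightarrow> real ^ 'd) \<Rightarrow>
     nat \<Rightarrow> (nat \<Rightarrow> real) \<Rightarrow> (nat \<Rightarrow> 'w \<Rightarrow> real ^ 'd) \<Rightarrow> real \<Rightarrow> 'w \<Rightarrow> real" where
  "simple_integral B n \<tau> \<phi> t \<omega> =
     (\<Sum>i<n. \<phi> i \<omega> \<bullet> (B (min t (\<tau> (Suc i))) \<omega> - B (min t (\<tau> i)) \<omega>))"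

definition brownian_integrable ::
    "'w measure \<Rightarrow> real \<Rightarrow> (real \<Rightarrow> 'w \<Rightarrow> real ^ 'd) \<Rightarrow> (real \<Rightarrow> 'w \<Rightarrow> real ^ 'd) \<Rightarrow> bool" where
  "brownian_integrable M T B Z \<longleftrightarrow>
     predictable M T (brownian_filtration M B) Z \<and>
     (AE \<omega> in M. (\<integral>\<^sup>+s\<in>{0..T}. ennreal ((norm (Z s \<omega>))\<^sup>2) \<partial>lborel) < \<infinity>)"

text \<open>\<open>I\<close> is a version of the process \<open>\<integral>\<^sub>0\<^sup>t Z dB\<close>, \<open>0 \<le> t \<le> T\<close>: continuous, adapted, and at
  each time the limit in probability of integrals of simple processes approximating \<open>Z\<close> in
  \<open>L\<^sup>2([0,T])\<close> in probability. For a \<open>B\<close>-integrable \<open>Z\<close> such an \<open>I\<close> exists and is unique up to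
  indistinguishability; it does not depend on the approximating sequence.\<close>

definition ito_integral ::
    "'w measure \<Rightarrow> real \<Rightarrow> (real \<Rightarrow> 'w \<Rightarrow> real ^ 'd) \<Rightarrow>
     (real \<Rightarrow> 'w \<Rightarrow> real ^ 'd) \<Rightarrow> (real \<Rightarrow> 'w \<Rightarrow> real) \<Rightarrow> bool" where
  "ito_integral M T B Z I \<longleftrightarrow>
     (\<forall>t\<in>{0..T}. I t \<in> borel_measurable (brownian_filtration M B t)) \<and>
     (AE \<omega> in M. continuous_on {0..T} (\<lambda>t. I t \<omega>)) \<and>
     (\<exists>n \<tau> \<phi>.
        (\<forall>m. simple_integrand M T (brownian_filtration M B) (n m) (\<tau> m) (\<phi> m)) \<and>
        (\<forall>\<epsilon>>0. (\<lambda>m. measure M {\<omega>\<in>space M.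
           (\<integral>\<^sup>+s\<in>{0..T}. ennreal ((norm (simple_process (n m) (\<tau> m) (\<phi> m) s \<omega> - Z s \<omega>))\<^sup>2) \<partial>lborel)
             > ennreal \<epsilon>}) \<longlonglongrightarrow> 0) \<and>
        (\<forall>t\<in>{0..T}. \<forall>\<epsilon>>0. (\<lambda>m. measure M {\<omega>\<in>space M.
           \<bar>simple_integral B (n m) (\<tau> m) (\<phi> m) t \<omega> - I t \<omega>\<bar> > \<epsilon>}) \<longlonglongrightarrow> 0))"

section \<open>The BSDE\<close>

definition fenchel_legendre :: "('a::real_inner \<Rightarrow> real) \<Rightarrow> 'a \<Rightarrow> ereal" where
  "fenchel_legendre g x = (SUP z. ereal (z \<bullet> x - g z))"

text \<open>The pair \<open>(Y, Z)\<close> is a bounded solution of \<open>dY = g(Z) dt - Z dB\<close>, \<open>Y\<^sub>T = \<xi>\<close>.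
  The generator \<open>g\<close> is meant to be nonnegative, so that \<open>E[\<integral> g(Z) dt]\<close> is a
  nonnegative integral.\<close>

definition bounded_bsde_solution_pair ::
    "'w measure \<Rightarrow> real \<Rightarrow> (real \<Rightarrow> 'w \<Rightarrow> real ^ 'd) \<Rightarrow> (real ^ 'd \<Rightarrow> real) \<Rightarrow> ('w \<Rightarrow> real) \<Rightarrow>
     (real \<Rightarrow> 'w \<Rightarrow> real) \<Rightarrow> (real \<Rightarrow> 'w \<Rightarrow> real ^ 'd) \<Rightarrow> bool" where
  "bounded_bsde_solution_pair M T B g \<xi> Y Z \<longleftrightarrow>
     predictable M T (brownian_filtration M B) Y \<and>
     bounded_process M T Y \<and>
     brownian_integrable M T B Z \<and>
     (\<integral>\<^sup>+\<omega>. (\<integral>\<^sup>+s\<in>{0..T}. ennreal (g (Z s \<omega>)) \<partial>lborel) \<partial>M) < \<infinity> \<and>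
     (\<exists>I. ito_integral M T B Z I \<and>
        (AE \<omega> in M. \<forall>t\<in>{0..T}.
           Y t \<omega> = \<xi> \<omega> - (LINT s:{t..T}|lborel. g (Z s \<omega>)) + (I T \<omega> - I t \<omega>)))"

definition bounded_bsde_solution ::
    "'w measure \<Rightarrow> real \<Rightarrow> (real \<Rightarrow> 'w \<Rightarrow> real ^ 'd) \<Rightarrow> (real ^ 'd \<Rightarrow> real) \<Rightarrow> ('w \<Rightarrow> real) \<Rightarrow>
     (real \<Rightarrow> 'w \<Rightarrow> real) \<Rightarrow> bool" where
  "bounded_bsde_solution M T B g \<xi> Y \<longleftrightarrow> (\<exists>Z. bounded_bsde_solution_pair M T B g \<xi> Y Z)"

end

theory Submission
  imports Defs
begin

text \<open>With \<open>Z = z\<close> constant over a time \<open>\<Delta>\<close>, the equation has drift \<open>g(z)\<Delta>\<close> and noise of size \<open>|z|\<surd>\<Delta>\<close>.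
  As \<open>g(z)/|z|\<^sup>2\<close> is unbounded, one can make the drift of order \<open>1\<close> while both \<open>\<Delta>\<close> and the noise are as small
  as desired, so a bounded solution can rise from \<open>y < 1\<close> to exactly \<open>1\<close> within an arbitrarily short time
  interval. On a sequence of ever shorter blocks with suitable \<open>z\<^sub>j\<close>, one runs the equation until it
  leaves \<open>(L\<^sub>j\<^sub>+\<^sub>1, 1)\<close>, where \<open>L\<^sub>j\<close> decreases to \<open>y - \<epsilon>\<close>, and then waits for the next block; a block in
  which the noise stays below \<open>\<epsilon>/2\<^sup>j\<^sup>+\<^sup>2\<close> ends at \<open>1\<close>, and block \<open>j\<close> fails this with probability at most \<open>2\<^sup>-\<^sup>j\<close>. Hence
  almost surely only finitely many blocks are used, which makes the stochastic integral a finite sum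
  of stopped Brownian increments.

  Letting \<open>Y\<^sup>k\<close> rise from \<open>-1/(k+1)\<close> to \<open>1\<close> just after time \<open>T/2\<close>, during intervals that move
  down to \<open>T/2\<close>, gives solutions with \<open>\<xi>\<^sub>k = \<xi> = 1\<close> that increase to the indicator of \<open>(T/2, T]\<close>. Its paths
  jump, whereas solutions have continuous paths.\<close>

section \<open>The augmented filtration and stopping times\<close>

text \<open>The equation is solved forward: Z is prescribed, Y starts from a constant, and the
  difficulty is to end at exactly 1 while Y stays bounded. One block cannot achieve this, since
  Gaussian noise exceeds every bound with positive probability; hence the infinite supply of
  retries. A failed retry may lower the process, so the lower barriers descend by amounts whose
  total is \<epsilon>. Each block costs at most a fixed amount of drift, and it is used only if its
  predecessor failed, so the probabilities make the expected cost summable. Monotonicity in k comes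
  from interlocking rather than from comparison of solutions. The time intervals of consecutive
  processes abut: up to the moment when a process starts to rise it is constant, and its successor
  never falls below that constant; from that moment on the successor equals 1. The permitted dip
  \<epsilon> is the gap between consecutive starting levels, which is why these levels increase
  strictly to 0 instead of being 0.\<close>

lemma space_brownian_filtration [simp]: "space (brownian_filtration M B t) = space M"
  unfolding brownian_filtration_def
  by (rule space_measure_of) (auto dest: sets.sets_into_space null_setsD2)

lemma sets_brownian_filtration:
  "sets (brownian_filtration M B t) = sigma_sets (space M)
     ({B s -` A \<inter> space M |s A. s \<in> {0..t} \<and> A \<in> sets borel} \<union> null_sets M)"
  unfolding brownian_filtration_def
  by (rule sets_measure_of) (auto dest: sets.sets_into_space null_setsD2)

lemma sets_brownian_filtration_mono:
  "s \<le> t \<Longrightarrow> sets (brownian_filtration M B s) \<subseteq> sets (brownian_filtration M B t)"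
  unfolding sets_brownian_filtration
  by (rule sigma_sets_mono', rule Un_mono[OF _ subset_refl]) (auto intro: order_trans)

lemma null_sets_brownian_filtration:
  "N \<in> null_sets M \<Longrightarrow> N \<in> sets (brownian_filtration M B t)"
  unfolding sets_brownian_filtration by (rule sigma_sets.Basic) simp

lemma measurable_brownian_filtration:
  fixes B :: "real \<Rightarrow> 'w \<Rightarrow> real ^ 'd"
  assumes "s \<in> {0..t}"
  shows "B s \<in> borel_measurable (brownian_filtration M B t)"
proof (rule measurableI)
  fix A :: "(real ^ 'd) set" assume "A \<in> sets borel"
  then have "B s -` A \<inter> space M \<in> sets (brownian_filtration M B t)"
    unfolding sets_brownian_filtration using assms by (intro sigma_sets.Basic) blast
  then show "B s -` A \<inter> space (brownian_filtration M B t) \<in> sets (brownian_filtration M B t)"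
    by simp
qed simp

lemma measurable_brownian_filtration_mono:
  assumes "f \<in> borel_measurable (brownian_filtration M B s)" "s \<le> t"
  shows "f \<in> borel_measurable (brownian_filtration M B t)"
  using assms sets_brownian_filtration_mono[OF assms(2), of M B]
  by (auto simp: measurable_def)

locale brownian_space = prob_space M
  for M :: "'w measure" +
  fixes T :: real and B :: "real \<Rightarrow> 'w \<Rightarrow> real ^ 'd"
  assumes T_pos: "0 < T"
    and standard_BM: "standard_brownian_motion M T B"
begin

abbreviation F :: "real \<Rightarrow> 'w measure" where
  "F \<equiv> brownian_filtration M B"

abbreviation Pred :: "(real \<times> 'w) measure" where
  "Pred \<equiv> predictable_sigma M T F"

lemma B_measurable: "t \<in> {0..T} \<Longrightarrow> B t \<in> borel_measurable M"
  using standard_BM unfolding standard_brownian_motion_def by blast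

lemma sets_F_subset:
  assumes "t \<le> T" shows "sets (F t) \<subseteq> sets M"
proof -
  have "sigma_sets (space M)
     ({B s -` A \<inter> space M |s A. s \<in> {0..t} \<and> A \<in> sets borel} \<union> null_sets M) \<subseteq> sets M"
  proof (rule sets.sigma_sets_subset)
    show "{B s -` A \<inter> space M |s A. s \<in> {0..t} \<and> A \<in> sets borel} \<union> null_sets M \<subseteq> sets M"
      using assms by (auto intro!: measurable_sets[OF B_measurable])
  qed
  then show ?thesis by (simp add: sets_brownian_filtration)
qed

lemma measurable_F_imp:
  assumes "f \<in> borel_measurable (F t)" "t \<le> T"
  shows "f \<in> borel_measurable M"
  using assms(1) sets_F_subset[OF assms(2)] by (auto simp: measurable_def)

text \<open>The set of discontinuous paths need not belong to \<open>sets M\<close>, so a measurable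
  null set covering it is fixed once and for all.\<close>

definition irregular :: "'w set" where
  "irregular = (SOME N. N \<in> null_sets M \<and>
     {\<omega> \<in> space M. \<not> continuous_on {0..T} (\<lambda>t. B t \<omega>)} \<subseteq> N)"

lemma irregular: "irregular \<in> null_sets M"
  "\<omega> \<in> space M \<Longrightarrow> \<omega> \<notin> irregular \<Longrightarrow> continuous_on {0..T} (\<lambda>t. B t \<omega>)"
proof -
  have "AE \<omega> in M. continuous_on {0..T} (\<lambda>t. B t \<omega>)"
    using standard_BM unfolding standard_brownian_motion_def by blast
  then obtain N where "{\<omega> \<in> space M. \<not> continuous_on {0..T} (\<lambda>t. B t \<omega>)} \<subseteq> N"
      "emeasure M N = 0" "N \<in> sets M"
    by (rule AE_E)
  then have "\<exists>N. N \<in> null_sets M \<and>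
     {\<omega> \<in> space M. \<not> continuous_on {0..T} (\<lambda>t. B t \<omega>)} \<subseteq> N"
    by (intro exI[of _ N]) (simp add: null_sets_def)
  from someI_ex[OF this]
  have *: "irregular \<in> null_sets M \<and>
     {\<omega> \<in> space M. \<not> continuous_on {0..T} (\<lambda>t. B t \<omega>)} \<subseteq> irregular"
    unfolding irregular_def .
  show "irregular \<in> null_sets M" using * by blast
  show "\<omega> \<in> space M \<Longrightarrow> \<omega> \<notin> irregular \<Longrightarrow> continuous_on {0..T} (\<lambda>t. B t \<omega>)"
    using * by blast
qed

lemma AE_regular: "AE \<omega> in M. \<omega> \<notin> irregular"
  using irregular(1) by (rule AE_not_in)

text \<open>All paths of \<open>W\<close> are continuous, so that hitting times need no exceptional set.\<close>

definition W :: "real \<Rightarrow> 'w \<Rightarrow> real ^ 'd" where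
  "W t \<omega> = (if \<omega> \<in> irregular then 0 else B t \<omega>)"

lemma W_eq: "\<omega> \<notin> irregular \<Longrightarrow> W t \<omega> = B t \<omega>"
  by (simp add: W_def)

text \<open>The augmentation is used here: null sets lie in every \<open>F t\<close>, even in
  \<open>F 0\<close>, so a process can be redefined on one without losing adaptedness.\<close>

lemma measurable_If_null:
  fixes f :: "'w \<Rightarrow> 'b::topological_space"
  assumes "f \<in> borel_measurable (F t)" "g \<in> borel_measurable (F t)" "N \<in> null_sets M"
  shows "(\<lambda>\<omega>. if \<omega> \<in> N then f \<omega> else g \<omega>) \<in> borel_measurable (F t)"
proof (rule measurable_If_set[OF assms(1,2)])
  show "N \<inter> space (F t) \<in> sets (F t)"
    by (rule sets.Int[OF null_sets_brownian_filtration[OF assms(3)] sets.top])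
qed

section \<open>Continuous adapted processes and stopping times\<close>

definition continuous_adapted :: "(real \<Rightarrow> 'w \<Rightarrow> 'b::topological_space) \<Rightarrow> bool" where
  "continuous_adapted X \<longleftrightarrow> (\<forall>t\<in>{0..T}. X t \<in> borel_measurable (F t)) \<and>
     (\<forall>\<omega>\<in>space M. continuous_on {0..T} (\<lambda>t. X t \<omega>))"

lemma continuous_adapted_measurable_F:
  assumes "continuous_adapted X" "0 \<le> s" "s \<le> t" "t \<le> T"
  shows "X s \<in> borel_measurable (F t)"
  using assms measurable_brownian_filtration_mono[of "X s" M B s t]
  unfolding continuous_adapted_def by auto

lemma continuous_adapted_measurable:
  "continuous_adapted X \<Longrightarrow> t \<in> {0..T} \<Longrightarrow> X t \<in> borel_measurable M"
  using measurable_F_imp[of "X t" t] unfolding continuous_adapted_def by auto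

lemma continuous_adapted_paths:
  "continuous_adapted X \<Longrightarrow> \<omega> \<in> space M \<Longrightarrow> continuous_on {0..T} (\<lambda>t. X t \<omega>)"
  unfolding continuous_adapted_def by blast

lemma continuous_adapted_W: "continuous_adapted W"
  unfolding continuous_adapted_def
proof (intro conjI ballI)
  fix t assume "t \<in> {0..T}"
  then show "W t \<in> borel_measurable (F t)"
    unfolding W_def[abs_def]
    by (intro measurable_If_null irregular(1) measurable_brownian_filtration) auto
next
  fix \<omega> assume "\<omega> \<in> space M"
  then show "continuous_on {0..T} (\<lambda>t. W t \<omega>)"
    using irregular(2)[of \<omega>] by (cases "\<omega> \<in> irregular") (auto simp: W_def)
qed

definition stopping :: "('w \<Rightarrow> real) \<Rightarrow> bool" where
  "stopping \<sigma> \<longleftrightarrow> (\<forall>\<omega>\<in>space M. \<sigma> \<omega> \<in> {0..T}) \<and>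
     (\<forall>r\<in>{0..T}. {\<omega> \<in> space M. \<sigma> \<omega> \<le> r} \<in> sets (F r))"

lemma stopping_const: "s \<in> {0..T} \<Longrightarrow> stopping (\<lambda>_. s)"
  unfolding stopping_def
proof (intro conjI ballI)
  fix r assume "r \<in> {0..T}"
  show "{\<omega> \<in> space M. s \<le> r} \<in> sets (F r)"
    using sets.top[of "F r"] by (cases "s \<le> r") simp_all
qed

lemma stopping_less:
  assumes "stopping \<sigma>" "r \<in> {0..T}"
  shows "{\<omega> \<in> space M. r < \<sigma> \<omega>} \<in> sets (F r)"
proof -
  have "{\<omega> \<in> space M. r < \<sigma> \<omega>} = space (F r) - {\<omega> \<in> space M. \<sigma> \<omega> \<le> r}"
    by auto
  also have "\<dots> \<in> sets (F r)"
    using assms unfolding stopping_def by (intro sets.compl_sets) blast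
  finally show ?thesis .
qed

end

section \<open>Discretised stopping and hitting times\<close>

text \<open>The least multiple of \<open>h\<close> not below \<open>x\<close>. Rounding goes up
  because a grid cell is kept exactly when its left end precedes a random time, and this is known at
  the left end.\<close>

definition round_up :: "real \<Rightarrow> real \<Rightarrow> real" where
  "round_up h x = h * of_int \<lceil>x / h\<rceil>"

lemma round_up_bounds:
  assumes "0 < h"
  shows "x \<le> round_up h x" "round_up h x < x + h"
proof -
  have "h * (x / h) \<le> h * of_int \<lceil>x / h\<rceil>" "h * of_int \<lceil>x / h\<rceil> < h * (x / h + 1)"
    by (intro mult_left_mono mult_strict_left_mono; use assms in linarith)+
  then show "x \<le> round_up h x" "round_up h x < x + h"
    using assms unfolding round_up_def by (simp_all add: distrib_left)
qed

lemma round_up_mono: "0 < h \<Longrightarrow> x \<le> y \<Longrightarrow> round_up h x \<le> round_up h y"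
  unfolding round_up_def by (simp add: ceiling_mono divide_right_mono)

text \<open>The cells whose left end lies below \<open>b\<close> form an initial segment of the
  grid, so the sum telescopes.\<close>

lemma sum_grid_below:
  fixes v :: "real \<Rightarrow> 'b::real_vector"
  assumes h: "0 < h" and b: "0 \<le> b" "b \<le> real K * h"
  shows "(\<Sum>i<K. indicator {..<b} (real i * h) *\<^sub>R (v (real (Suc i) * h) - v (real i * h)))
    = v (round_up h b) - v 0"
proof -
  define m where "m = nat \<lceil>b / h\<rceil>"
  have m: "round_up h b = real m * h" unfolding m_def round_up_def
    using h b by (simp add: mult.commute)
  have mK: "m \<le> K" unfolding m_def using h b by (simp add: nat_le_iff ceiling_le_iff field_simps)
  have less: "real i * h < b \<longleftrightarrow> i < m" for i
  proof -
    have "real i * h < b \<longleftrightarrow> of_int (int i) < b / h" using h by (simp add: field_simps)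
    also have "\<dots> \<longleftrightarrow> int i < \<lceil>b / h\<rceil>" by (rule less_ceiling_iff[symmetric])
    also have "\<dots> \<longleftrightarrow> i < m" unfolding m_def by linarith
    finally show ?thesis .
  qed
  have "(\<Sum>i<K. indicator {..<b} (real i * h) *\<^sub>R (v (real (Suc i) * h) - v (real i * h)))
    = (\<Sum>i<m. v (real (Suc i) * h) - v (real i * h))"
    using mK by (intro sum.mono_neutral_cong_right) (auto simp: less indicator_def)
  also have "\<dots> = v (real m * h) - v (real 0 * h)" by (rule sum_lessThan_telescope)
  finally show ?thesis using m by simp
qed

lemma sum_grid_between:
  fixes v :: "real \<Rightarrow> 'b::real_vector"
  assumes h: "0 < h" and ab: "0 \<le> a" "a \<le> b" "b \<le> real K * h"
  shows "(\<Sum>i<K. indicator {a..<b} (real i * h) *\<^sub>R (v (real (Suc i) * h) - v (real i * h)))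
    = v (round_up h b) - v (round_up h a)"
proof -
  have "indicator {a..<b} x = (indicator {..<b} x - indicator {..<a} x :: real)" for x
    using ab by (auto simp: indicator_def)
  then have "(\<Sum>i<K. indicator {a..<b} (real i * h) *\<^sub>R (v (real (Suc i) * h) - v (real i * h)))
    = (\<Sum>i<K. indicator {..<b} (real i * h) *\<^sub>R (v (real (Suc i) * h) - v (real i * h)))
     - (\<Sum>i<K. indicator {..<a} (real i * h) *\<^sub>R (v (real (Suc i) * h) - v (real i * h)))"
    by (simp only: scaleR_left_diff_distrib sum_subtractf)
  also have "\<dots> = v (round_up h b) - v (round_up h a)"
    using ab by (subst (1 2) sum_grid_below[OF h]) auto
  finally show ?thesis .
qed

lemma sum_grid_indicator:
  assumes h: "0 < h" and ab: "0 \<le> a" "a \<le> b" "b \<le> real K * h"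
  shows "(\<Sum>i<K. indicator {real i * h<..real (Suc i) * h} s *\<^sub>R indicator {a..<b} (real i * h))
    = (indicator {round_up h a<..round_up h b} s :: real)"
proof -
  \<comment> \<open>The indicator of a cell, evaluated at \<open>s\<close>, is the increment over
    that cell of the step function jumping at \<open>s\<close>; this makes the sum
    telescope.\<close>
  define v :: "real \<Rightarrow> real" where "v r = indicator {s..} r" for r
  have "indicator {real i * h<..real (Suc i) * h} s = v (real (Suc i) * h) - v (real i * h)" for i
    using h by (auto simp: v_def indicator_def algebra_simps)
  then have "(\<Sum>i<K. indicator {real i * h<..real (Suc i) * h} s *\<^sub>R indicator {a..<b} (real i * h))
    = (\<Sum>i<K. indicator {a..<b} (real i * h) *\<^sub>R (v (real (Suc i) * h) - v (real i * h)))"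
    by (intro sum.cong) auto
  also have "\<dots> = v (round_up h b) - v (round_up h a)"
    by (rule sum_grid_between[OF h ab])
  also have "\<dots> = indicator {round_up h a<..round_up h b} s"
    using round_up_mono[OF h ab(2)] by (auto simp: v_def indicator_def)
  finally show ?thesis .
qed

lemma divide_Suc_tendsto_zero: "(\<lambda>m. c / real (Suc m)) \<longlonglongrightarrow> (0 :: real)"
proof -
  have "(\<lambda>m. c * (1 / real (Suc m))) \<longlonglongrightarrow> c * 0"
    by (intro tendsto_mult tendsto_const LIMSEQ_Suc lim_1_over_n)
  then show ?thesis by simp
qed

lemma round_up_tendsto:
  assumes "0 < T"
  shows "(\<lambda>m. round_up (T / real (Suc m)) x) \<longlonglongrightarrow> x"
proof (rule tendsto_sandwich[of "\<lambda>_. x" _ _ "\<lambda>m. x + T / real (Suc m)"])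
  have "(\<lambda>m. x + T / real (Suc m)) \<longlonglongrightarrow> x + 0"
    by (intro tendsto_add tendsto_const divide_Suc_tendsto_zero)
  then show "(\<lambda>m. x + T / real (Suc m)) \<longlonglongrightarrow> x" by simp
qed (use round_up_bounds[of "T / real (Suc _)"] assms in \<open>auto intro!: always_eventually less_imp_le\<close>)

text \<open>The grid sizes \<open>N m\<close> are left general, to cover both uniform grids with
  \<open>Suc m\<close> cells and dyadic grids.\<close>

lemma floor_grid_tendsto:
  fixes x :: real and N :: "nat \<Rightarrow> real"
  assumes "0 \<le> x" and N: "filterlim N at_top sequentially"
  shows "(\<lambda>m. real (nat \<lfloor>N m * x\<rfloor>) / N m) \<longlonglongrightarrow> x"
proof (rule tendsto_sandwich)
  have pos: "\<forall>\<^sub>F m in sequentially. 0 < N m"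
    using N by (rule filterlim_at_top_dense[THEN iffD1, THEN spec])
  have "(\<lambda>m. x - 1 / N m) \<longlonglongrightarrow> x - 0"
    by (intro tendsto_diff tendsto_const tendsto_divide_0[OF tendsto_const] filterlim_at_top_imp_at_infinity[OF N])
  then show "(\<lambda>m. x - 1 / N m) \<longlonglongrightarrow> x" by simp
  have bounds: "x - 1 / N m \<le> real (nat \<lfloor>N m * x\<rfloor>) / N m \<and> real (nat \<lfloor>N m * x\<rfloor>) / N m \<le> x"
    if "0 < N m" for m
  proof -
    have "0 \<le> N m * x" using assms(1) that by simp
    then have "real (nat \<lfloor>N m * x\<rfloor>) \<le> N m * x" "N m * x - 1 \<le> real (nat \<lfloor>N m * x\<rfloor>)"
      by linarith+
    from this[THEN divide_right_mono, of "N m"] show ?thesis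
      using that by (simp add: diff_divide_distrib)
  qed
  show "\<forall>\<^sub>F m in sequentially. x - 1 / N m \<le> real (nat \<lfloor>N m * x\<rfloor>) / N m"
    "\<forall>\<^sub>F m in sequentially. real (nat \<lfloor>N m * x\<rfloor>) / N m \<le> x"
    using pos by (auto elim!: eventually_mono dest: bounds)
qed (rule tendsto_const)

text \<open>The condition involves only countably many values of \<open>f\<close>, which makes hitting times
  measurable.\<close>

lemma continuous_nonpos_value_iff:
  fixes f :: "real \<Rightarrow> real"
  assumes f: "continuous_on {s..r} f" and "s \<le> r"
  shows "(\<exists>q\<in>{s..r}. f q \<le> 0) \<longleftrightarrow>
    (\<forall>n. \<exists>m i. i \<le> m \<and> f (s + (r - s) * (real i / real m)) < 1 / real (Suc n))"
proof
  assume "\<exists>q\<in>{s..r}. f q \<le> 0"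
  then obtain q where q: "q \<in> {s..r}" "f q \<le> 0" by blast
  \<comment> \<open>The value 0 handles the degenerate interval \<open>r = s\<close>.\<close>
  define x where "x = (if r = s then 0 else (q - s) / (r - s))"
  have x: "0 \<le> x" "x \<le> 1" "q = s + (r - s) * x"
    using q \<open>s \<le> r\<close> by (auto simp: x_def field_simps)
  define w where "w m = s + (r - s) * (real (nat \<lfloor>real (Suc m) * x\<rfloor>) / real (Suc m))" for m
  have le: "nat \<lfloor>real (Suc m) * x\<rfloor> \<le> Suc m" for m
  proof -
    have "real (Suc m) * x \<le> real (Suc m)" using x by (simp add: mult_left_le)
    then show ?thesis by linarith
  qed
  have w_in: "w m \<in> {s..r}" for m
  proof -
    have "real (nat \<lfloor>real (Suc m) * x\<rfloor>) / real (Suc m) \<le> 1" using le[of m] by simp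
    then have "(r - s) * (real (nat \<lfloor>real (Suc m) * x\<rfloor>) / real (Suc m)) \<le> (r - s) * 1"
      using \<open>s \<le> r\<close> by (intro mult_left_mono) auto
    then show ?thesis unfolding w_def using \<open>s \<le> r\<close> by auto
  qed
  have "(\<lambda>m. real (nat \<lfloor>real (Suc m) * x\<rfloor>) / real (Suc m)) \<longlonglongrightarrow> x"
    using x(1) by (rule floor_grid_tendsto) (intro filterlim_compose[OF filterlim_real_sequentially filterlim_Suc])
  then have "w \<longlonglongrightarrow> q" unfolding w_def x(3) by (intro tendsto_intros)
  then have "(\<lambda>m. f (w m)) \<longlonglongrightarrow> f q"
    using f q w_in by (auto simp: continuous_on_sequentially comp_def)
  show "\<forall>n. \<exists>m i. i \<le> m \<and> f (s + (r - s) * (real i / real m)) < 1 / real (Suc n)"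
  proof
    fix n
    have "f q < 1 / real (Suc n)" using q(2) by (rule le_less_trans) simp
    with \<open>(\<lambda>m. f (w m)) \<longlonglongrightarrow> f q\<close> have "\<forall>\<^sub>F m in sequentially. f (w m) < 1 / real (Suc n)"
      by (rule order_tendstoD)
    then obtain m where "f (w m) < 1 / real (Suc n)" by (auto simp: eventually_sequentially)
    then show "\<exists>m i. i \<le> m \<and> f (s + (r - s) * (real i / real m)) < 1 / real (Suc n)"
      using le[of m] unfolding w_def by blast
  qed
next
  assume *: "\<forall>n. \<exists>m i. i \<le> m \<and> f (s + (r - s) * (real i / real m)) < 1 / real (Suc n)"
  \<comment> \<open>A minimum exists by compactness, and the grid values force it below every
    \<open>1 / real (Suc n)\<close>.\<close>
  obtain q where q: "q \<in> {s..r}" "\<And>p. p \<in> {s..r} \<Longrightarrow> f q \<le> f p"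
    using continuous_attains_inf[OF compact_Icc _ f] \<open>s \<le> r\<close> by auto
  have "f q \<le> 1 / real (Suc n)" for n
  proof -
    from * obtain m i where mi: "i \<le> m" "f (s + (r - s) * (real i / real m)) < 1 / real (Suc n)"
      by blast
    \<comment> \<open>For \<open>m = 0\<close> the quotient is 0 by convention and the grid point is
      \<open>s\<close>, still inside the interval.\<close>
    have "real i / real m \<le> 1" using mi(1) by (auto simp: divide_le_eq_1)
    then have "(r - s) * (real i / real m) \<le> (r - s) * 1"
      using \<open>s \<le> r\<close> by (intro mult_left_mono) auto
    then have "s + (r - s) * (real i / real m) \<in> {s..r}" using \<open>s \<le> r\<close> by auto
    then show ?thesis using q(2) mi(2) by (meson le_less_trans less_imp_le)
  qed
  then have "f q \<le> 0" by (intro LIMSEQ_le_const[OF divide_Suc_tendsto_zero]) auto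
  then show "\<exists>q\<in>{s..r}. f q \<le> 0" using q(1) by blast
qed

section \<open>Hitting times and stopped processes\<close>

context brownian_space
begin

text \<open>Inserting \<open>e\<close> caps the time at \<open>e\<close> and keeps the set nonempty,
  so \<open>Inf\<close> is meaningful even if the nonpositive half-line is never reached.\<close>

definition hitting :: "(real \<Rightarrow> 'w \<Rightarrow> real) \<Rightarrow> real \<Rightarrow> real \<Rightarrow> 'w \<Rightarrow> real" where
  "hitting X s e \<omega> = Inf (insert e {r \<in> {s..e}. X r \<omega> \<le> 0})"

lemma hitting_bounds:
  assumes "s \<le> e" shows "hitting X s e \<omega> \<in> {s..e}"
proof -
  have "s \<le> hitting X s e \<omega>" unfolding hitting_def using assms by (intro cInf_greatest) auto
  moreover have "hitting X s e \<omega> \<le> e"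
    unfolding hitting_def using assms by (intro cInf_lower bdd_belowI[of _ s]) auto
  ultimately show ?thesis by simp
qed

lemma before_hitting:
  assumes "s \<le> r" "r < hitting X s e \<omega>" "s \<le> e"
  shows "0 < X r \<omega>"
proof (rule ccontr)
  assume "\<not> 0 < X r \<omega>"
  then have "hitting X s e \<omega> \<le> r"
    unfolding hitting_def using assms hitting_bounds[OF \<open>s \<le> e\<close>, of X \<omega>]
    by (intro cInf_lower bdd_belowI[of _ s]) auto
  then show False using assms by simp
qed

lemma hitting_closed:
  assumes "continuous_on {s..e} (\<lambda>r. X r \<omega>)" "s \<le> e"
  shows "hitting X s e \<omega> = e \<or> X (hitting X s e \<omega>) \<omega> \<le> 0"
proof -
  let ?S = "insert e {r \<in> {s..e}. X r \<omega> \<le> 0}"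
  have "closed {r \<in> {s..e}. X r \<omega> \<le> 0}"
    using assms(1) by (intro continuous_on_closed_Collect_le continuous_on_const closed_atLeastAtMost)
  then have "Inf ?S \<in> ?S"
    using assms(2) by (intro closed_contains_Inf bdd_belowI[of _ s]) auto
  then show ?thesis unfolding hitting_def by auto
qed

lemma hitting_le_iff:
  assumes "continuous_on {s..e} (\<lambda>r. X r \<omega>)" "s \<le> r" "r < e"
  shows "hitting X s e \<omega> \<le> r \<longleftrightarrow> (\<exists>q\<in>{s..r}. X q \<omega> \<le> 0)"
proof
  assume "hitting X s e \<omega> \<le> r"
  then show "\<exists>q\<in>{s..r}. X q \<omega> \<le> 0"
    using hitting_closed[of s e X \<omega>] assms(1) hitting_bounds[of s e X \<omega>] assms(2,3)
    by (intro bexI[of _ "hitting X s e \<omega>"]) auto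
next
  assume "\<exists>q\<in>{s..r}. X q \<omega> \<le> 0"
  then obtain q where "q \<in> {s..r}" "X q \<omega> \<le> 0" by blast
  then show "hitting X s e \<omega> \<le> r"
    using before_hitting[of s q X e \<omega>] assms(2,3) by force
qed

text \<open>Strictly before the hitting time \<open>X\<close> is positive, and continuity carries
  the weak inequality to the hitting time itself. If the two coincide at \<open>s\<close>, the
  assumption on \<open>X s \<omega>\<close> is all there is.\<close>

lemma nonneg_until_hitting:
  assumes X: "continuous_on {s..e} (\<lambda>r. X r \<omega>)" and "s \<le> e" "0 \<le> X s \<omega>"
    and r: "s \<le> r" "r \<le> hitting X s e \<omega>"
  shows "0 \<le> X r \<omega>"
proof (cases "r < hitting X s e \<omega> \<or> r = s")
  case True
  then show ?thesis using before_hitting[of s r X e \<omega>] assms by force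
next
  case False
  then have r': "r = hitting X s e \<omega>" "s < r" using r by auto
  have re: "r \<le> e" using r' hitting_bounds[OF \<open>s \<le> e\<close>, of X \<omega>] by simp
  have "continuous_on {s..r} (\<lambda>r. X r \<omega>)" using X by (rule continuous_on_subset) (use re in auto)
  moreover have "closure {s..<r} = {s..r}" using r' by simp
  moreover have "0 \<le> X p \<omega>" if "p \<in> {s..<r}" for p
    using before_hitting[of s p X e \<omega>] that \<open>s \<le> e\<close> r' by force
  ultimately show ?thesis
    using continuous_ge_on_closure[of "{s..<r}" "\<lambda>r. X r \<omega>" r 0] r' by auto
qed

text \<open>Since the target is closed and paths are continuous, a hitting time at most
  \<open>r < e\<close> means that a nonpositive value occurs within \<open>{s..r}\<close>. That
  event is decided by countably many values at times up to \<open>r\<close>, hence lies in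
  \<open>F r\<close>.\<close>

lemma stopping_hitting:
  assumes X: "continuous_adapted X" and se: "0 \<le> s" "s \<le> e" "e \<le> T"
  shows "stopping (hitting X s e)"
  unfolding stopping_def
proof (intro conjI ballI)
  show "hitting X s e \<omega> \<in> {0..T}" for \<omega> using hitting_bounds[OF se(2), of X \<omega>] se by auto
  fix r assume r: "r \<in> {0..T}"
  consider "r < s" | "s \<le> r" "r < e" | "e \<le> r" by linarith
  then show "{\<omega> \<in> space M. hitting X s e \<omega> \<le> r} \<in> sets (F r)"
  proof cases
    case 1
    then have "{\<omega> \<in> space M. hitting X s e \<omega> \<le> r} = {}"
      using hitting_bounds[OF se(2), of X] by (auto simp: not_le intro: less_le_trans)
    then show ?thesis by (simp only: sets.empty_sets)
  next
    case 2
    have cont: "continuous_on {s..e} (\<lambda>q. X q \<omega>)" if "\<omega> \<in> space M" for \<omega>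
      by (rule continuous_on_subset[OF continuous_adapted_paths[OF X that]]) (use se in auto)
    have "hitting X s e \<omega> \<le> r \<longleftrightarrow>
       (\<forall>n. \<exists>m i. i \<le> m \<and> X (s + (r - s) * (real i / real m)) \<omega> < 1 / real (Suc n))"
      if "\<omega> \<in> space M" for \<omega>
      using hitting_le_iff[where X=X, OF cont[OF that] 2]
        continuous_nonpos_value_iff[of s r "\<lambda>q. X q \<omega>"]
        continuous_on_subset[OF cont[OF that], of "{s..r}"] 2 by auto
    then have "{\<omega> \<in> space M. hitting X s e \<omega> \<le> r} = {\<omega> \<in> space (F r).
       \<forall>n. \<exists>m i. i \<le> m \<and> X (s + (r - s) * (real i / real m)) \<omega> < 1 / real (Suc n)}"
      by auto
    also have "\<dots> \<in> sets (F r)"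
    proof (intro sets.sets_Collect_countable_All sets.sets_Collect_countable_Ex)
      fix n m i :: nat
      show "{\<omega> \<in> space (F r). i \<le> m \<and> X (s + (r - s) * (real i / real m)) \<omega> < 1 / real (Suc n)}
        \<in> sets (F r)"
      proof (cases "i \<le> m")
        case True
        then have "real i / real m \<le> 1" by (auto simp: divide_le_eq_1)
        then have "(r - s) * (real i / real m) \<le> (r - s) * 1"
          using 2 by (intro mult_left_mono) auto
        then have "X (s + (r - s) * (real i / real m)) \<in> borel_measurable (F r)"
          using se r 2 by (intro continuous_adapted_measurable_F[OF X]) auto
        then have "{\<omega> \<in> space (F r). X (s + (r - s) * (real i / real m)) \<omega> < 1 / real (Suc n)}
          \<in> sets (F r)" by measurable
        then show ?thesis using True by (simp only: simp_thms)
      qed simp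
    qed
    finally show ?thesis .
  next
    case 3
    then have "{\<omega> \<in> space M. hitting X s e \<omega> \<le> r} = space M"
      using hitting_bounds[OF se(2), of X] by (auto intro: order_trans)
    then show ?thesis using sets.top[of "F r"] by simp
  qed
qed

text \<open>The stopped value is a limit of telescoping grid sums in which a cell is kept when
  \<open>\<sigma>\<close> exceeds its left end. Cells that start after \<open>t\<close> have zero
  increment, so only events already in \<open>F t\<close> contribute.\<close>

lemma continuous_adapted_stopped:
  fixes X :: "real \<Rightarrow> 'w \<Rightarrow> 'b::{second_countable_topology, real_normed_vector}"
  assumes X: "continuous_adapted X" and \<sigma>: "stopping \<sigma>"
  shows "continuous_adapted (\<lambda>t \<omega>. X (min t (\<sigma> \<omega>)) \<omega>)"
  unfolding continuous_adapted_def
proof (intro conjI ballI)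
  fix \<omega> assume \<omega>: "\<omega> \<in> space M"
  then have "\<sigma> \<omega> \<in> {0..T}" using \<sigma> unfolding stopping_def by blast
  then show "continuous_on {0..T} (\<lambda>t. X (min t (\<sigma> \<omega>)) \<omega>)"
    by (intro continuous_on_compose2[OF continuous_adapted_paths[OF X \<omega>]] continuous_intros) auto
next
  fix t assume t: "t \<in> {0..T}"
  define h where "h m = T / real (Suc m)" for m
  have h: "0 < h m" "real (Suc m) * h m = T" for m using T_pos by (auto simp: h_def field_simps)
  define S where "S m \<omega> = X 0 \<omega> + (\<Sum>i<Suc m. indicator {..<\<sigma> \<omega>} (real i * h m) *\<^sub>R
      (X (min t (real (Suc i) * h m)) \<omega> - X (min t (real i * h m)) \<omega>))" for m \<omega>
  show "(\<lambda>\<omega>. X (min t (\<sigma> \<omega>)) \<omega>) \<in> borel_measurable (F t)"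
  proof (rule borel_measurable_LIMSEQ_metric)
    fix m
    have "(\<lambda>\<omega>. indicator {..<\<sigma> \<omega>} (real i * h m) *\<^sub>R
      (X (min t (real (Suc i) * h m)) \<omega> - X (min t (real i * h m)) \<omega>)) \<in> borel_measurable (F t)"
      if "i < Suc m" for i
    proof (cases "real i * h m \<le> t")
      case True
      have ih: "real i * h m \<in> {0..T}" using True t h(1)[of m] by (auto intro: order_trans)
      have "{\<omega> \<in> space M. real i * h m < \<sigma> \<omega>} \<in> sets (F t)"
        using stopping_less[OF \<sigma> ih] sets_brownian_filtration_mono[OF True, of M B] by (rule subsetD[rotated])
      then have "(\<lambda>\<omega>. indicator {\<omega> \<in> space M. real i * h m < \<sigma> \<omega>} \<omega> :: real) \<in> borel_measurable (F t)"
        by (rule borel_measurable_indicator)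
      then have "(\<lambda>\<omega>. indicator {..<\<sigma> \<omega>} (real i * h m) :: real) \<in> borel_measurable (F t)"
        by (rule measurable_cong[THEN iffD1, rotated]) (auto simp: indicator_def)
      moreover have "X (min t (real (Suc i) * h m)) \<in> borel_measurable (F t)"
        "X (min t (real i * h m)) \<in> borel_measurable (F t)"
        using t h(1)[of m] by (auto intro!: continuous_adapted_measurable_F[OF X])
      ultimately show ?thesis by measurable
    next
      case False
      then have "min t (real i * h m) = t" "min t (real (Suc i) * h m) = t"
        using h(1)[of m] by (auto simp: algebra_simps)
      then show ?thesis by simp
    qed
    moreover have "X 0 \<in> borel_measurable (F t)" using t by (intro continuous_adapted_measurable_F[OF X]) auto
    ultimately show "S m \<in> borel_measurable (F t)"
      unfolding S_def by (intro borel_measurable_add borel_measurable_sum) auto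
  next
    fix \<omega> assume "\<omega> \<in> space (F t)"
    then have \<omega>: "\<omega> \<in> space M" by simp
    then have \<sigma>\<omega>: "\<sigma> \<omega> \<in> {0..T}" using \<sigma> unfolding stopping_def by blast
    have "S m \<omega> = X (min t (round_up (h m) (\<sigma> \<omega>))) \<omega>" for m
      unfolding S_def
      using sum_grid_below[OF h(1), of "\<sigma> \<omega>" "Suc m" m "\<lambda>r. X (min t r) \<omega>"] \<sigma>\<omega> h(2)[of m] t by simp
    moreover have "(\<lambda>m. X (min t (round_up (h m) (\<sigma> \<omega>))) \<omega>) \<longlonglongrightarrow> X (min t (\<sigma> \<omega>)) \<omega>"
    proof (rule continuous_on_tendsto_compose[OF continuous_adapted_paths[OF X \<omega>]])
      show "(\<lambda>m. min t (round_up (h m) (\<sigma> \<omega>))) \<longlonglongrightarrow> min t (\<sigma> \<omega>)"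
        unfolding h_def by (intro tendsto_min tendsto_const round_up_tendsto T_pos)
      show "\<forall>\<^sub>F m in sequentially. min t (round_up (h m) (\<sigma> \<omega>)) \<in> {0..T}"
        using t \<sigma>\<omega> round_up_bounds(1)[OF h(1), of "\<sigma> \<omega>"]
        by (auto intro!: always_eventually simp: min_le_iff_disj intro: order_trans)
    qed (use t \<sigma>\<omega> in auto)
    ultimately show "(\<lambda>m. S m \<omega>) \<longlonglongrightarrow> X (min t (\<sigma> \<omega>)) \<omega>" by simp
  qed
qed

end

section \<open>Predictability\<close>

text \<open>Dominated convergence for the indicators. The sets \<open>A m\<close> may be
  non-measurable: \<open>measure\<close> then gives 0, and such a set can be replaced by the empty
  one.\<close>

lemma (in prob_space) measure_tendsto_zero_AE:
  assumes "AE \<omega> in M. \<forall>\<^sub>F m in sequentially. \<omega> \<notin> A m"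
  shows "(\<lambda>m. measure M (A m)) \<longlonglongrightarrow> 0"
proof -
  define A' where "A' m = (if A m \<in> sets M then A m else {})" for m
  have [measurable]: "A' m \<in> sets M" for m by (simp add: A'_def)
  have "(\<lambda>m. integral\<^sup>L M (indicator (A' m) :: _ \<Rightarrow> real)) \<longlonglongrightarrow> integral\<^sup>L M (\<lambda>_. 0 :: real)"
  proof (rule integral_dominated_convergence[where w="\<lambda>_. 1"])
    show "AE \<omega> in M. (\<lambda>m. indicator (A' m) \<omega> :: real) \<longlonglongrightarrow> 0"
      using assms
    proof eventually_elim
      case (elim \<omega>)
      then show ?case
        by (intro tendsto_eventually) (auto elim!: eventually_mono simp: A'_def indicator_def)
    qed
  qed auto
  moreover have "measure M (A m) = integral\<^sup>L M (indicator (A' m))" for m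
    by (simp add: A'_def measure_notin_sets)
  ultimately show ?thesis by simp
qed

context brownian_space
begin

lemma predictable_generators:
  "{{0} \<times> A |A. A \<in> sets (F 0)} \<union>
        {{s<..t} \<times> A |s t A. 0 \<le> s \<and> s < t \<and> t \<le> T \<and> A \<in> sets (F s)} \<subseteq> Pow ({0..T} \<times> space M)"
  using T_pos sets.sets_into_space[of _ "F _"] by fastforce

lemma space_Pred [simp]: "space Pred = {0..T} \<times> space M"
  unfolding predictable_sigma_def by (rule space_measure_of[OF predictable_generators])

lemma sets_Pred_zero:
  assumes "A \<in> sets (F 0)" shows "{0} \<times> A \<in> sets Pred"
proof -
  have "{0} \<times> A \<in> sigma_sets ({0..T} \<times> space M) ({{0} \<times> A |A. A \<in> sets (F 0)} \<union>
        {{s<..t} \<times> A |s t A. 0 \<le> s \<and> s < t \<and> t \<le> T \<and> A \<in> sets (F s)})"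
    using assms by (intro sigma_sets.Basic) blast
  then show ?thesis
    unfolding predictable_sigma_def sets_measure_of[OF predictable_generators] .
qed

lemma sets_Pred_block:
  assumes "A \<in> sets (F s)" "0 \<le> s" "s < t" "t \<le> T" shows "{s<..t} \<times> A \<in> sets Pred"
proof -
  have "{s<..t} \<times> A \<in> sigma_sets ({0..T} \<times> space M) ({{0} \<times> A |A. A \<in> sets (F 0)} \<union>
        {{s<..t} \<times> A |s t A. 0 \<le> s \<and> s < t \<and> t \<le> T \<and> A \<in> sets (F s)})"
    using assms by (intro sigma_sets.Basic) blast
  then show ?thesis
    unfolding predictable_sigma_def sets_measure_of[OF predictable_generators] .
qed

text \<open>The assumption on \<open>S\<close> covers both kinds of generators of the predictable
  sets, \<open>{0}\<close> and \<open>{s<..t}\<close>.\<close>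

lemma measurable_Pred_if:
  fixes f :: "'w \<Rightarrow> 'b::real_normed_vector"
  assumes f: "f \<in> borel_measurable (F s)"
    and S: "\<And>A. A \<in> sets (F s) \<Longrightarrow> S \<times> A \<in> sets Pred"
  shows "(\<lambda>(t, \<omega>). indicator S t *\<^sub>R f \<omega>) \<in> borel_measurable Pred"
proof (rule measurableI)
  fix A :: "'b set" assume A: "A \<in> sets borel"
  have 1: "S \<times> (f -` A \<inter> space M) \<in> sets Pred"
    using S[OF measurable_sets[OF f A]] by simp
  have 2: "space Pred - S \<times> space M \<in> sets Pred"
    using S[OF sets.top] by (intro sets.compl_sets) simp
  have SM: "S \<times> space M \<subseteq> {0..T} \<times> space M"
    using sets.sets_into_space[OF S[OF sets.top]] by simp
  have "(\<lambda>(t, \<omega>). indicator S t *\<^sub>R f \<omega>) -` A \<inter> space Pred =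
    S \<times> (f -` A \<inter> space M) \<union> (if 0 \<in> A then space Pred - S \<times> space M else {})"
    using SM by (auto simp: indicator_def of_bool_def split: if_splits)
  also have "\<dots> \<in> sets Pred" using 1 2 by auto
  finally show "(\<lambda>(t, \<omega>). indicator S t *\<^sub>R f \<omega>) -` A \<inter> space Pred \<in> sets Pred" .
qed simp

text \<open>A left-continuous path is the limit of step processes that hold the value from the left
  end of each cell, and these are built from the generators. Time 0 lies in no cell and gets its own
  summand.\<close>

lemma predictable_continuous_adapted:
  fixes X :: "real \<Rightarrow> 'w \<Rightarrow> 'b::{second_countable_topology, real_normed_vector}"
  assumes X: "continuous_adapted X"
  shows "predictable M T F X"
  unfolding predictable_def
proof (rule borel_measurable_LIMSEQ_metric)
  define h where "h m = T / real (Suc m)" for m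
  have h: "0 < h m" "real (Suc m) * h m = T" for m using T_pos by (auto simp: h_def field_simps)
  define S where "S m = (\<lambda>(t, \<omega>). indicator {0} t *\<^sub>R X 0 \<omega> +
      (\<Sum>i<Suc m. indicator {real i * h m<..real (Suc i) * h m} t *\<^sub>R X (real i * h m) \<omega>))" for m
  show "S m \<in> borel_measurable Pred" for m
    unfolding S_def case_prod_beta
  proof (intro borel_measurable_add borel_measurable_sum)
    show "(\<lambda>x. indicator {0} (fst x) *\<^sub>R X 0 (snd x)) \<in> borel_measurable Pred"
      using measurable_Pred_if[OF continuous_adapted_measurable_F[OF X, of 0 0], of "{0}"] T_pos sets_Pred_zero
      by (simp add: case_prod_unfold)
    fix i assume i: "i \<in> {..<Suc m}"
    then have "real (Suc i) * h m \<le> real (Suc m) * h m"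
      using h(1)[of m] by (intro mult_right_mono) auto
    then have "0 \<le> real i * h m" "real i * h m < real (Suc i) * h m" "real (Suc i) * h m \<le> T"
      unfolding h(2) using h(1)[of m] by (auto simp: algebra_simps)
    then show "(\<lambda>x. indicator {real i * h m<..real (Suc i) * h m} (fst x) *\<^sub>R
        X (real i * h m) (snd x)) \<in> borel_measurable Pred"
      using measurable_Pred_if[OF continuous_adapted_measurable_F[OF X, of "real i * h m" "real i * h m"]]
        sets_Pred_block[of _ "real i * h m" "real (Suc i) * h m"]
      by (simp add: case_prod_unfold del: of_nat_Suc)
  qed
  fix x assume "x \<in> space Pred"
  then obtain t \<omega> where x: "x = (t, \<omega>)" and t: "t \<in> {0..T}" and \<omega>: "\<omega> \<in> space M" by auto
  show "(\<lambda>m. S m x) \<longlonglongrightarrow> (case x of (t, \<omega>) \<Rightarrow> X t \<omega>)"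
  proof (cases "t = 0")
    case True
    have "S m x = X 0 \<omega>" for m
    proof -
      have "indicator {real i * h m<..real (Suc i) * h m} (0::real) = (0::real)" for i
        using h(1)[of m] by (simp add: indicator_def not_less)
      then have "(\<Sum>i<Suc m. indicator {real i * h m<..real (Suc i) * h m} (0::real) *\<^sub>R
          X (real i * h m) \<omega>) = 0"
        by (simp only: scaleR_zero_left sum.neutral_const)
      then show ?thesis using True unfolding S_def x by (simp del: sum.lessThan_Suc of_nat_Suc)
    qed
    then show ?thesis using True x by simp
  next
    case False
    then have t0: "0 < t" using t by simp
    \<comment> \<open>Exactly one cell contains \<open>t > 0\<close>; its right end is
      \<open>t\<close> rounded up, so its left end is one mesh earlier.\<close>
    have S_eq: "S m x = X (round_up (h m) t - h m) \<omega>" for m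
    proof -
      have "t / h m \<le> real (Suc m)" using t h(2)[of m] h(1)[of m]
        by (simp add: pos_divide_le_eq)
      moreover have "0 < t / h m" using t0 h(1)[of m] by simp
      ultimately have pos: "0 < \<lceil>t / h m\<rceil>" and le: "\<lceil>t / h m\<rceil> \<le> int (Suc m)"
        by (simp_all add: ceiling_le_iff)
      define k where "k = nat (\<lceil>t / h m\<rceil> - 1)"
      have k: "\<lceil>t / h m\<rceil> = int (Suc k)" "k < Suc m" using pos le by (auto simp: k_def)
      have "t \<in> {real i * h m<..real (Suc i) * h m} \<longleftrightarrow> i = k" for i
      proof -
        have "t \<in> {real i * h m<..real (Suc i) * h m} \<longleftrightarrow>
            of_int (int (Suc i)) - 1 < t / h m \<and> t / h m \<le> of_int (int (Suc i))"
          using h(1)[of m] by (simp add: pos_less_divide_eq pos_divide_le_eq)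
        also have "\<dots> \<longleftrightarrow> \<lceil>t / h m\<rceil> = int (Suc i)" by (rule ceiling_eq_iff[symmetric])
        finally show ?thesis using k by auto
      qed
      then have "(\<Sum>i<Suc m. indicator {real i * h m<..real (Suc i) * h m} t *\<^sub>R X (real i * h m) \<omega>)
          = (\<Sum>i<Suc m. if i = k then X (real i * h m) \<omega> else 0)"
        by (intro sum.cong) (auto simp: indicator_def simp del: of_nat_Suc)
      then have "S m x = (\<Sum>i<Suc m. if i = k then X (real i * h m) \<omega> else 0)"
        unfolding S_def x using False by (simp del: sum.lessThan_Suc of_nat_Suc)
      also have "\<dots> = X (real k * h m) \<omega>" using k by simp
      also have "real k * h m = round_up (h m) t - h m"
        unfolding round_up_def k(1) by (simp add: algebra_simps)
      finally show ?thesis .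
    qed
    have "(\<lambda>m. X (round_up (h m) t - h m) \<omega>) \<longlonglongrightarrow> X t \<omega>"
    proof (rule continuous_on_tendsto_compose[OF continuous_adapted_paths[OF X \<omega>]])
      have "(\<lambda>m. round_up (h m) t - h m) \<longlonglongrightarrow> t - 0"
        unfolding h_def by (intro tendsto_diff round_up_tendsto divide_Suc_tendsto_zero T_pos)
      then show "(\<lambda>m. round_up (h m) t - h m) \<longlonglongrightarrow> t" by simp
      have "0 \<le> round_up (h m) t - h m" for m
      proof -
        have "1 \<le> \<lceil>t / h m\<rceil>" using t0 h(1)[of m] by (simp add: less_eq_int_code)
        then have "h m * 1 \<le> h m * of_int \<lceil>t / h m\<rceil>"
          using h(1)[of m] by (intro mult_left_mono) auto
        then show ?thesis unfolding round_up_def by simp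
      qed
      moreover have "round_up (h m) t - h m \<le> T" for m
        using round_up_bounds(2)[OF h(1), of m t] t by auto
      ultimately show "\<forall>\<^sub>F m in sequentially. round_up (h m) t - h m \<in> {0..T}"
        by simp
    qed (use t in auto)
    then show ?thesis using S_eq x by simp
  qed
qed

text \<open>The times after \<open>\<sigma>\<close> are exhausted by countably many rectangles:
  whenever \<open>\<sigma> \<omega> < t\<close>, a rational \<open>q\<close> lies in between, and
  the event that \<open>\<sigma>\<close> is at most \<open>q\<close> is known at time
  \<open>q\<close>.\<close>

lemma sets_Pred_stochastic_interval:
  assumes \<sigma>: "stopping \<sigma>" and s: "s \<in> {0..T}"
  shows "{x \<in> space Pred. s < fst x \<and> fst x \<le> \<sigma> (snd x)} \<in> sets Pred"
proof -
  have 1: "{s<..T} \<times> space M \<in> sets Pred"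
  proof (cases "s < T")
    case True
    then show ?thesis using sets_Pred_block[OF sets.top[of "F s"]] s by simp
  next
    case False
    then have "{s<..T} \<times> space M = {}" by auto
    then show ?thesis by (simp only: sets.empty_sets)
  qed
  have 2: "{q<..T} \<times> {\<omega> \<in> space M. \<sigma> \<omega> \<le> q} \<in> sets Pred" if "q \<in> \<rat> \<inter> {0..<T}" for q
    using \<sigma> that unfolding stopping_def by (intro sets_Pred_block) auto
  have "{x \<in> space Pred. s < fst x \<and> fst x \<le> \<sigma> (snd x)} =
    {s<..T} \<times> space M - (\<Union>q\<in>\<rat> \<inter> {0..<T}. {q<..T} \<times> {\<omega> \<in> space M. \<sigma> \<omega> \<le> q})"
    (is "?L = ?R")
  proof (intro equalityI subsetI)
    fix x assume "x \<in> ?L"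
    then show "x \<in> ?R" by (cases x) auto
  next
    fix x assume x: "x \<in> ?R"
    obtain t \<omega> where [simp]: "x = (t, \<omega>)" by (cases x)
    have "t \<le> \<sigma> \<omega>"
    proof (rule ccontr)
      assume "\<not> t \<le> \<sigma> \<omega>"
      then obtain q where q: "q \<in> \<rat>" "\<sigma> \<omega> < q" "q < t"
        using Rats_dense_in_real[of "\<sigma> \<omega>" t] by auto
      have "0 \<le> \<sigma> \<omega>" using \<sigma> x unfolding stopping_def by auto
      then show False using q x by (auto dest!: bspec[of _ _ q])
    qed
    then show "x \<in> ?L" using x s by auto
  qed
  also have "\<dots> \<in> sets Pred"
    using 1 2 by (intro sets.Diff sets.countable_UN'' countable_Int1 countable_rat) auto
  finally show ?thesis .
qed

text \<open>Predictable generators are product measurable. The indicator extends \<open>f\<close> by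
  zero to all of the product space, which makes Tonelli's theorem applicable to integrals along
  paths.\<close>

lemma measurable_predictable_pair:
  fixes f :: "real \<times> 'w \<Rightarrow> 'b::real_normed_vector"
  assumes "f \<in> borel_measurable Pred"
  shows "(\<lambda>x. indicator {0..T} (fst x) *\<^sub>R f x) \<in> borel_measurable (borel \<Otimes>\<^sub>M M)"
    (is "_ \<in> borel_measurable ?P")
proof -
  have rect: "I \<times> A \<in> sets ?P" if "I \<in> sets borel" "A \<in> sets (F s)" "s \<le> T" for s I A
    using that sets_F_subset[of s] by (intro pair_measureI) auto
  let ?\<Omega> = "{0..T} \<times> space M"
  have \<Omega>: "?\<Omega> \<in> sets ?P" by (intro pair_measureI) auto
  have space: "space (restrict_space ?P ?\<Omega>) = ?\<Omega>"
    by (auto simp: space_restrict_space space_pair_measure)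
  have "(\<lambda>x. x) \<in> restrict_space ?P ?\<Omega> \<rightarrow>\<^sub>M Pred"
    unfolding predictable_sigma_def
  proof (rule measurable_measure_of[OF predictable_generators])
    fix G assume G: "G \<in> {{0} \<times> A |A. A \<in> sets (F 0)} \<union>
        {{s<..t} \<times> A |s t A. 0 \<le> s \<and> s < t \<and> t \<le> T \<and> A \<in> sets (F s)}"
    then have "G \<in> sets ?P" using T_pos rect[of "{0}"] rect[of "{_<.._}"] by auto
    moreover have "G \<subseteq> ?\<Omega>" using G predictable_generators by blast
    ultimately show "(\<lambda>x. x) -` G \<inter> space (restrict_space ?P ?\<Omega>) \<in> sets (restrict_space ?P ?\<Omega>)"
      using \<Omega> by (simp add: space sets_restrict_space_iff Int_absorb2)
  qed (simp add: space)
  from measurable_compose[OF this assms]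
  have "(\<lambda>x. indicator ?\<Omega> x *\<^sub>R f x) \<in> borel_measurable ?P"
    using \<Omega> borel_measurable_restrict_space_iff[of ?\<Omega> ?P f] by simp
  then show ?thesis
    by (rule measurable_cong[THEN iffD1, rotated]) (auto simp: indicator_def space_pair_measure)
qed

end

section \<open>The Ito integral of a sequence of stopped blocks\<close>

text \<open>Shifting both ends to the right changes the indicator only on the two end strips, where
  the change has modulus at most 1.\<close>

lemma indicator_Ioc_diff_le:
  fixes a b a' b' s :: real
  assumes "a \<le> b" "a \<le> a'" "b \<le> b'" "a' \<le> b'"
  shows "(indicator {a'<..b'} s - indicator {a<..b} s)\<^sup>2
    \<le> (indicator {a<..a'} s + indicator {b<..b'} s :: real)"
  using assms by (auto simp: indicator_def)

text \<open>Blocks start at deterministic times and end at stopping times; a block with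
  \<open>\<sigma> j \<omega> = \<tau> j\<close> is empty. Overlaps are allowed, because integrand
  and integral are linear in the blocks.\<close>

locale brownian_blocks = brownian_space M T B
  for M :: "'w measure" and T :: real and B :: "real \<Rightarrow> 'w \<Rightarrow> real ^ 'd" +
  fixes \<tau> :: "nat \<Rightarrow> real" and \<sigma> :: "nat \<Rightarrow> 'w \<Rightarrow> real" and z :: "nat \<Rightarrow> real ^ 'd"
  assumes start: "\<And>j. \<tau> j \<in> {0..T}"
    and stop: "\<And>j. stopping (\<sigma> j)"
    and start_le: "\<And>j \<omega>. \<omega> \<in> space M \<Longrightarrow> \<tau> j \<le> \<sigma> j \<omega>"
    and AE_finitely_many: "AE \<omega> in M. \<exists>J. \<forall>j\<ge>J. \<sigma> j \<omega> = \<tau> j"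
begin

text \<open>The series is measurable whether or not it converges; on almost every path it is a
  finite sum.\<close>

definition Z :: "real \<Rightarrow> 'w \<Rightarrow> real ^ 'd" where
  "Z s \<omega> = (\<Sum>j. indicator {\<tau> j<..\<sigma> j \<omega>} s *\<^sub>R z j)"

definition I :: "real \<Rightarrow> 'w \<Rightarrow> real" where
  "I t \<omega> = (\<Sum>j. z j \<bullet> (W (min t (\<sigma> j \<omega>)) \<omega> - W (min t (\<tau> j)) \<omega>))"

lemma stop_le: "\<omega> \<in> space M \<Longrightarrow> \<sigma> j \<omega> \<le> T"
  using stop[of j] unfolding stopping_def by auto

lemma Z_finite:
  assumes "\<forall>j\<ge>J. \<sigma> j \<omega> = \<tau> j"
  shows "Z s \<omega> = (\<Sum>j<J. indicator {\<tau> j<..\<sigma> j \<omega>} s *\<^sub>R z j)"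
  unfolding Z_def using assms by (intro suminf_finite) auto

lemma I_finite:
  assumes "\<forall>j\<ge>J. \<sigma> j \<omega> = \<tau> j"
  shows "I t \<omega> = (\<Sum>j<J. z j \<bullet> (W (min t (\<sigma> j \<omega>)) \<omega> - W (min t (\<tau> j)) \<omega>))"
  unfolding I_def using assms by (intro suminf_finite) auto

lemma Z_measurable: "(\<lambda>(t, \<omega>). Z t \<omega>) \<in> borel_measurable Pred"
proof -
  have "(\<lambda>x. indicator {\<tau> j<..\<sigma> j (snd x)} (fst x) :: real) \<in> borel_measurable Pred" for j
  proof -
    have "(\<lambda>x. indicator {x \<in> space Pred. \<tau> j < fst x \<and> fst x \<le> \<sigma> j (snd x)} x :: real)
        \<in> borel_measurable Pred"
      by (intro borel_measurable_indicator sets_Pred_stochastic_interval stop start)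
    then show ?thesis
      by (rule measurable_cong[THEN iffD1, rotated]) (auto simp: indicator_def)
  qed
  then show ?thesis unfolding Z_def case_prod_unfold
    by (intro borel_measurable_suminf borel_measurable_scaleR borel_measurable_const)
qed

lemma Z_integrable: "brownian_integrable M T B Z"
  unfolding brownian_integrable_def predictable_def
proof (intro conjI Z_measurable)
  show "AE \<omega> in M. (\<integral>\<^sup>+s\<in>{0..T}. ennreal ((norm (Z s \<omega>))\<^sup>2) \<partial>lborel) < \<infinity>"
    using AE_finitely_many
  proof eventually_elim
    case (elim \<omega>)
    then obtain J where J: "\<forall>j\<ge>J. \<sigma> j \<omega> = \<tau> j" by blast
    have "norm (Z s \<omega>) \<le> (\<Sum>j<J. norm (z j))" for s
      unfolding Z_finite[OF J] by (rule sum_norm_le) (auto simp: indicator_def)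
    then have "(\<integral>\<^sup>+s\<in>{0..T}. ennreal ((norm (Z s \<omega>))\<^sup>2) \<partial>lborel)
      \<le> (\<integral>\<^sup>+s\<in>{0..T}. ennreal ((\<Sum>j<J. norm (z j))\<^sup>2) \<partial>lborel)"
      by (intro nn_integral_mono mult_right_mono ennreal_leI power_mono) auto
    also have "\<dots> < \<infinity>"
      using T_pos by (simp add: nn_integral_cmult_indicator ennreal_mult_less_top)
    finally show ?case .
  qed
qed

lemma I_adapted: "t \<in> {0..T} \<Longrightarrow> I t \<in> borel_measurable (F t)"
  unfolding I_def
proof (intro borel_measurable_suminf borel_measurable_inner borel_measurable_diff borel_measurable_const)
  fix j assume t: "t \<in> {0..T}"
  show "(\<lambda>\<omega>. W (min t (\<sigma> j \<omega>)) \<omega>) \<in> borel_measurable (F t)"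
    using continuous_adapted_stopped[OF continuous_adapted_W stop] t unfolding continuous_adapted_def by blast
  show "W (min t (\<tau> j)) \<in> borel_measurable (F t)"
    using t start[of j] by (intro continuous_adapted_measurable_F[OF continuous_adapted_W]) auto
qed

lemma continuous_on_W_min:
  assumes "\<omega> \<in> space M" "c \<in> {0..T}"
  shows "continuous_on {0..T} (\<lambda>t. W (min t c) \<omega>)"
  using assms(2)
  by (intro continuous_on_compose2[OF continuous_adapted_paths[OF continuous_adapted_W assms(1)]] continuous_intros)
    auto

lemma I_continuous: "AE \<omega> in M. continuous_on {0..T} (\<lambda>t. I t \<omega>)"
  using AE_finitely_many AE_space
proof eventually_elim
  case (elim \<omega>)
  then obtain J where J: "\<forall>j\<ge>J. \<sigma> j \<omega> = \<tau> j" by blast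
  show ?case unfolding I_finite[OF J]
    using start stop_le[OF elim(2)] start_le[OF elim(2)]
    by (intro continuous_intros continuous_on_W_min elim) (auto intro: order_trans)
qed

section \<open>Approximation of the block integrand by simple processes\<close>

definition mesh :: "nat \<Rightarrow> real" where
  "mesh m = T / real (Suc m)"

lemma mesh: "0 < mesh m" "real (Suc m) * mesh m = T"
  using T_pos by (auto simp: mesh_def field_simps)

lemma mesh_tendsto: "mesh \<longlonglongrightarrow> 0"
  unfolding mesh_def[abs_def] by (rule divide_Suc_tendsto_zero)

text \<open>The index \<open>m\<close> controls both the mesh and the number of blocks taken into
  account; the latter keeps \<open>\<phi> m i\<close> bounded. The test for block \<open>j\<close>
  includes \<open>\<tau> j\<close> and excludes \<open>\<sigma> j \<omega>\<close>, so it is decided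
  at the left end of the cell.\<close>

definition \<phi> :: "nat \<Rightarrow> nat \<Rightarrow> 'w \<Rightarrow> real ^ 'd" where
  "\<phi> m i \<omega> = (\<Sum>j<m. indicator {\<tau> j..<\<sigma> j \<omega>} (real i * mesh m) *\<^sub>R z j)"

lemma simple_integrand_\<phi>:
  "simple_integrand M T F (Suc m) (\<lambda>i. real i * mesh m) (\<phi> m)"
  unfolding simple_integrand_def
proof (intro conjI allI impI)
  fix i assume "i < Suc m"
  then have "real i * mesh m \<le> real (Suc m) * mesh m"
    using mesh(1)[of m] by (intro mult_right_mono) auto
  then have ih: "real i * mesh m \<in> {0..T}" using mesh(1)[of m] unfolding mesh(2) by auto
  have "(\<lambda>\<omega>. indicator {\<tau> j..<\<sigma> j \<omega>} (real i * mesh m) :: real) \<in> borel_measurable (F (real i * mesh m))"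
    for j
  proof -
    have "(\<lambda>\<omega>. indicator {\<tau> j..} (real i * mesh m) *
        indicator {\<omega> \<in> space M. real i * mesh m < \<sigma> j \<omega>} \<omega> :: real)
      \<in> borel_measurable (F (real i * mesh m))"
      by (intro borel_measurable_times borel_measurable_const borel_measurable_indicator
          stopping_less stop ih)
    then show ?thesis
      by (rule measurable_cong[THEN iffD1, rotated]) (auto simp: indicator_def)
  qed
  then show "\<phi> m i \<in> borel_measurable (F (real i * mesh m))"
    unfolding \<phi>_def by (intro borel_measurable_sum borel_measurable_scaleR borel_measurable_const)
  have "norm (\<phi> m i \<omega>) \<le> (\<Sum>j<m. norm (z j))" for \<omega>
    unfolding \<phi>_def by (rule sum_norm_le) (auto simp: indicator_def)
  then show "bounded (\<phi> m i ` space M)" by (auto simp: bounded_iff)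
next
  show "real (Suc m) * mesh m \<le> T" using mesh(2)[of m] by simp
qed (use mesh in \<open>auto simp: algebra_simps\<close>)

text \<open>After exchanging the sums, the grid sum for each block telescopes: discretising the
  integrand just rounds both ends of every block up to the grid.\<close>

lemma simple_process_\<phi>:
  assumes "\<omega> \<in> space M"
  shows "simple_process (Suc m) (\<lambda>i. real i * mesh m) (\<phi> m) s \<omega> =
    (\<Sum>j<m. indicator {round_up (mesh m) (\<tau> j)<..round_up (mesh m) (\<sigma> j \<omega>)} s *\<^sub>R z j)"
proof -
  have "simple_process (Suc m) (\<lambda>i. real i * mesh m) (\<phi> m) s \<omega> =
    (\<Sum>j<m. \<Sum>i<Suc m. indicator {real i * mesh m<..real (Suc i) * mesh m} s *\<^sub>R
        indicator {\<tau> j..<\<sigma> j \<omega>} (real i * mesh m) *\<^sub>R z j)"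
    unfolding simple_process_def \<phi>_def scaleR_sum_right by (rule sum.swap)
  also have "\<dots> = (\<Sum>j<m. (\<Sum>i<Suc m. indicator {real i * mesh m<..real (Suc i) * mesh m} s *\<^sub>R
        indicator {\<tau> j..<\<sigma> j \<omega>} (real i * mesh m)) *\<^sub>R z j)"
    by (simp only: scaleR_sum_left scaleR_scaleR real_scaleR_def)
  also have "\<dots> = (\<Sum>j<m. indicator {round_up (mesh m) (\<tau> j)<..round_up (mesh m) (\<sigma> j \<omega>)} s *\<^sub>R z j)"
    using start start_le[OF assms] stop_le[OF assms] mesh(2)[of m]
    by (subst sum_grid_indicator[OF mesh(1)]) auto
  finally show ?thesis .
qed

lemma simple_integral_\<phi>:
  assumes "\<omega> \<in> space M" "\<omega> \<notin> irregular"
  shows "simple_integral B (Suc m) (\<lambda>i. real i * mesh m) (\<phi> m) t \<omega> =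
    (\<Sum>j<m. z j \<bullet> (W (min t (round_up (mesh m) (\<sigma> j \<omega>))) \<omega> - W (min t (round_up (mesh m) (\<tau> j))) \<omega>))"
proof -
  have "simple_integral B (Suc m) (\<lambda>i. real i * mesh m) (\<phi> m) t \<omega> =
    (\<Sum>j<m. \<Sum>i<Suc m. indicator {\<tau> j..<\<sigma> j \<omega>} (real i * mesh m) *\<^sub>R
      (z j \<bullet> (W (min t (real (Suc i) * mesh m)) \<omega> - W (min t (real i * mesh m)) \<omega>)))"
    unfolding simple_integral_def \<phi>_def W_eq[OF assms(2)] inner_sum_left inner_scaleR_left
      real_scaleR_def by (rule sum.swap)
  also have "\<dots> = (\<Sum>j<m. z j \<bullet> W (min t (round_up (mesh m) (\<sigma> j \<omega>))) \<omega> -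
      z j \<bullet> W (min t (round_up (mesh m) (\<tau> j))) \<omega>)"
    unfolding inner_diff_right using start start_le[OF assms(1)] stop_le[OF assms(1)] mesh(2)[of m]
    by (intro sum.cong refl sum_grid_between[OF mesh(1), where v="\<lambda>r. z _ \<bullet> W (min t r) \<omega>"]) auto
  finally show ?thesis by (simp only: inner_diff_right)
qed

text \<open>Only the first \<open>J\<close> blocks are nonempty on this path. The Cauchy-Schwarz
  inequality over them gives the factor \<open>real J\<close>, and each block is wrong on two end
  strips of length at most \<open>mesh m\<close>.\<close>

lemma simple_process_\<phi>_diff_le:
  assumes \<omega>: "\<omega> \<in> space M" and J: "\<forall>j\<ge>J. \<sigma> j \<omega> = \<tau> j" and "J \<le> m"
  shows "(\<integral>\<^sup>+s\<in>{0..T}. ennreal ((norm (simple_process (Suc m) (\<lambda>i. real i * mesh m) (\<phi> m) s \<omega> - Z s \<omega>))\<^sup>2) \<partial>lborel)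
    \<le> ennreal (real J * (\<Sum>j<J. (norm (z j))\<^sup>2 * (2 * mesh m)))"
proof -
  define u where "u = round_up (mesh m)"
  have u: "x \<le> u x" "u x \<le> x + mesh m" for x
    unfolding u_def using round_up_bounds[OF mesh(1)[of m], of x] by auto
  define D where "D s j = (indicator {u (\<tau> j)<..u (\<sigma> j \<omega>)} s - indicator {\<tau> j<..\<sigma> j \<omega>} s :: real)" for s j
  define E where "E s j = (indicator {\<tau> j<..u (\<tau> j)} s + indicator {\<sigma> j \<omega><..u (\<sigma> j \<omega>)} s :: real)" for s j
  have DE: "(D s j)\<^sup>2 \<le> E s j" for s j
    unfolding D_def E_def using start_le[OF \<omega>] u(1)
    by (intro indicator_Ioc_diff_le) (auto simp: u_def intro!: round_up_mono mesh(1))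
  have "simple_process (Suc m) (\<lambda>i. real i * mesh m) (\<phi> m) s \<omega> =
     (\<Sum>j<J. indicator {u (\<tau> j)<..u (\<sigma> j \<omega>)} s *\<^sub>R z j)" for s
    unfolding simple_process_\<phi>[OF \<omega>] u_def using J \<open>J \<le> m\<close>
    by (intro sum.mono_neutral_right) auto
  then have diff: "simple_process (Suc m) (\<lambda>i. real i * mesh m) (\<phi> m) s \<omega> - Z s \<omega> = (\<Sum>j<J. D s j *\<^sub>R z j)" for s
    unfolding Z_finite[OF J] D_def by (simp add: sum_subtractf scaleR_left_diff_distrib)
  have "(norm (\<Sum>j<J. D s j *\<^sub>R z j))\<^sup>2 \<le> (\<Sum>j<J. real J * (norm (z j))\<^sup>2 * E s j)" for s
  proof -
    have "(norm (\<Sum>j<J. D s j *\<^sub>R z j))\<^sup>2 \<le> (\<Sum>j<J. \<bar>D s j\<bar> * norm (z j))\<^sup>2"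
      by (intro power_mono sum_norm_le) auto
    also have "\<dots> \<le> (\<Sum>j<J. (\<bar>D s j\<bar> * norm (z j))\<^sup>2) * card {..<J}"
      by (rule sum_squared_le_sum_of_squares) 
    also have "\<dots> = (\<Sum>j<J. real J * (norm (z j))\<^sup>2 * (D s j)\<^sup>2)"
      by (simp add: sum_distrib_left power_mult_distrib ac_simps)
    also have "\<dots> \<le> (\<Sum>j<J. real J * (norm (z j))\<^sup>2 * E s j)"
      by (intro sum_mono mult_left_mono DE) auto
    finally show ?thesis .
  qed
  then have "(\<integral>\<^sup>+s\<in>{0..T}. ennreal ((norm (simple_process (Suc m) (\<lambda>i. real i * mesh m) (\<phi> m) s \<omega> - Z s \<omega>))\<^sup>2) \<partial>lborel)
    \<le> (\<integral>\<^sup>+s. ennreal (\<Sum>j<J. real J * (norm (z j))\<^sup>2 * E s j) \<partial>lborel)"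
    unfolding diff by (intro nn_integral_mono) (auto simp: indicator_def intro!: ennreal_leI)
  also have "\<dots> = (\<integral>\<^sup>+s. (\<Sum>j<J. ennreal (real J * (norm (z j))\<^sup>2) *
      (indicator {\<tau> j<..u (\<tau> j)} s + indicator {\<sigma> j \<omega><..u (\<sigma> j \<omega>)} s)) \<partial>lborel)"
    by (intro nn_integral_cong)
      (auto simp: E_def sum_ennreal[symmetric] ennreal_mult ennreal_plus ennreal_indicator
        simp del: sum_ennreal intro!: sum.cong)
  also have "\<dots> = (\<Sum>j<J. ennreal (real J * (norm (z j))\<^sup>2) *
      (ennreal (u (\<tau> j) - \<tau> j) + ennreal (u (\<sigma> j \<omega>) - \<sigma> j \<omega>)))"
    using u(1) by (simp add: nn_integral_sum nn_integral_cmult nn_integral_add)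
  also have "\<dots> \<le> (\<Sum>j<J. ennreal (real J * (norm (z j))\<^sup>2) * ennreal (2 * mesh m))"
  proof (intro sum_mono mult_left_mono)
    fix j
    have "u (\<tau> j) - \<tau> j \<le> mesh m" "u (\<sigma> j \<omega>) - \<sigma> j \<omega> \<le> mesh m"
      using u(2)[of "\<tau> j"] u(2)[of "\<sigma> j \<omega>"] by auto
    then show "ennreal (u (\<tau> j) - \<tau> j) + ennreal (u (\<sigma> j \<omega>) - \<sigma> j \<omega>) \<le> ennreal (2 * mesh m)"
      using u(1)[of "\<tau> j"] u(1)[of "\<sigma> j \<omega>"] by (simp flip: ennreal_plus add: ennreal_leI)
  qed simp
  also have "\<dots> = ennreal (\<Sum>j<J. real J * (norm (z j))\<^sup>2 * (2 * mesh m))"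
    using mesh(1)[of m] by (simp add: ennreal_mult[symmetric] sum_ennreal)
  also have "(\<Sum>j<J. real J * (norm (z j))\<^sup>2 * (2 * mesh m)) = real J * (\<Sum>j<J. (norm (z j))\<^sup>2 * (2 * mesh m))"
    by (simp add: sum_distrib_left mult.assoc)
  finally show ?thesis .
qed

text \<open>Both approximations converge on almost every path, because there they involve finitely
  many blocks and a continuous path of \<open>W\<close>. Convergence in probability follows.\<close>

lemma ito_integral_I: "ito_integral M T B Z I"
  unfolding ito_integral_def
proof (intro conjI ballI I_adapted I_continuous exI[of _ Suc] exI[of _ "\<lambda>m i. real i * mesh m"]
    exI[of _ \<phi>] allI impI simple_integrand_\<phi>)
  fix \<epsilon> :: real assume \<epsilon>: "0 < \<epsilon>"
  show "(\<lambda>m. measure M {\<omega>\<in>space M.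
       (\<integral>\<^sup>+s\<in>{0..T}. ennreal ((norm (simple_process (Suc m) (\<lambda>i. real i * mesh m) (\<phi> m) s \<omega> - Z s \<omega>))\<^sup>2) \<partial>lborel)
       > ennreal \<epsilon>}) \<longlonglongrightarrow> 0"
  proof (rule measure_tendsto_zero_AE)
    show "AE \<omega> in M. \<forall>\<^sub>F m in sequentially. \<omega> \<notin> {\<omega>\<in>space M.
       (\<integral>\<^sup>+s\<in>{0..T}. ennreal ((norm (simple_process (Suc m) (\<lambda>i. real i * mesh m) (\<phi> m) s \<omega> - Z s \<omega>))\<^sup>2) \<partial>lborel)
       > ennreal \<epsilon>}"
      using AE_finitely_many AE_space
    proof eventually_elim
      case (elim \<omega>)
      then obtain J where J: "\<forall>j\<ge>J. \<sigma> j \<omega> = \<tau> j" by blast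
      have "(\<lambda>m. real J * (\<Sum>j<J. (norm (z j))\<^sup>2 * (2 * mesh m))) \<longlonglongrightarrow>
          real J * (\<Sum>j<J. (norm (z j))\<^sup>2 * (2 * 0))"
        by (intro tendsto_intros mesh_tendsto)
      then have "\<forall>\<^sub>F m in sequentially. real J * (\<Sum>j<J. (norm (z j))\<^sup>2 * (2 * mesh m)) < \<epsilon>"
        using \<epsilon> by (intro order_tendstoD) auto
      with eventually_ge_at_top[of J] show ?case
      proof eventually_elim
        case (elim m)
        then show ?case
          using simple_process_\<phi>_diff_le[OF \<open>\<omega> \<in> space M\<close> J, of m]
          by (auto simp: not_less intro: order_trans ennreal_leI less_imp_le)
      qed
    qed
  qed
next
  fix t \<epsilon> :: real assume t: "t \<in> {0..T}" and \<epsilon>: "0 < \<epsilon>"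
  show "(\<lambda>m. measure M {\<omega>\<in>space M.
     \<bar>simple_integral B (Suc m) (\<lambda>i. real i * mesh m) (\<phi> m) t \<omega> - I t \<omega>\<bar> > \<epsilon>}) \<longlonglongrightarrow> 0"
  proof (rule measure_tendsto_zero_AE)
    show "AE \<omega> in M. \<forall>\<^sub>F m in sequentially. \<omega> \<notin> {\<omega>\<in>space M.
     \<bar>simple_integral B (Suc m) (\<lambda>i. real i * mesh m) (\<phi> m) t \<omega> - I t \<omega>\<bar> > \<epsilon>}"
      using AE_finitely_many AE_space AE_regular
    proof eventually_elim
      case (elim \<omega>)
      then obtain J where J: "\<forall>j\<ge>J. \<sigma> j \<omega> = \<tau> j" by blast
      have W_tendsto: "(\<lambda>m. W (min t (round_up (mesh m) c)) \<omega>) \<longlonglongrightarrow> W (min t c) \<omega>" if "0 \<le> c" for c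
      proof (rule continuous_on_tendsto_compose[OF continuous_adapted_paths[OF continuous_adapted_W elim(2)]])
        show "(\<lambda>m. min t (round_up (mesh m) c)) \<longlonglongrightarrow> min t c"
          unfolding mesh_def by (intro tendsto_min tendsto_const round_up_tendsto T_pos)
        show "\<forall>\<^sub>F m in sequentially. min t (round_up (mesh m) c) \<in> {0..T}"
          using t that round_up_bounds(1)[OF mesh(1), of c]
          by (auto intro!: always_eventually simp: min_le_iff_disj intro: order_trans)
      qed (use t that in auto)
      have nonneg: "0 \<le> \<tau> j" "0 \<le> \<sigma> j \<omega>" for j
        using start[of j] start_le[OF elim(2), of j] by auto
      have "(\<lambda>m. \<Sum>j<J. z j \<bullet> (W (min t (round_up (mesh m) (\<sigma> j \<omega>))) \<omega> -
          W (min t (round_up (mesh m) (\<tau> j))) \<omega>)) \<longlonglongrightarrow> I t \<omega>"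
        unfolding I_finite[OF J] by (intro tendsto_intros W_tendsto nonneg)
      then have "\<forall>\<^sub>F m in sequentially. dist (\<Sum>j<J. z j \<bullet> (W (min t (round_up (mesh m) (\<sigma> j \<omega>))) \<omega> -
          W (min t (round_up (mesh m) (\<tau> j))) \<omega>)) (I t \<omega>) < \<epsilon>"
        using \<epsilon> by (rule tendstoD)
      with eventually_ge_at_top[of J] show ?case
      proof eventually_elim
        case (elim m)
        have "simple_integral B (Suc m) (\<lambda>i. real i * mesh m) (\<phi> m) t \<omega> =
          (\<Sum>j<J. z j \<bullet> (W (min t (round_up (mesh m) (\<sigma> j \<omega>))) \<omega> -
            W (min t (round_up (mesh m) (\<tau> j))) \<omega>))"
          unfolding simple_integral_\<phi>[OF \<open>\<omega> \<in> space M\<close> \<open>\<omega> \<notin> irregular\<close>] using J elim(1)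
          by (intro sum.mono_neutral_right) auto
        then show ?case using elim(2) by (simp add: dist_real_def)
      qed
    qed
  qed
qed

end

section \<open>A maximal inequality for Brownian motion\<close>

lemma Basis_vec_real: "(Basis :: (real ^ 'd) set) = range (\<lambda>k. axis k 1)"
  by (auto simp: Basis_vec_def)

lemma nn_integral_normal_fourth_moment:
  assumes "0 < \<sigma>"
  shows "(\<integral>\<^sup>+y. ennreal (normal_density 0 \<sigma> y * y ^ 4) \<partial>lborel) = ennreal (3 * \<sigma> ^ 4)"
proof -
  have "has_bochner_integral lborel (\<lambda>y. normal_density 0 \<sigma> y * (y - 0) ^ (2 * 2))
      (fact (2 * 2) / ((2 / \<sigma>\<^sup>2)\<^sup>2 * fact 2))"
    by (rule normal_moment_even[OF assms])
  also have "fact (2 * 2) / ((2 / \<sigma>\<^sup>2)\<^sup>2 * fact 2) = 3 * \<sigma> ^ 4"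
    using assms by (simp add: fact_numeral power_divide field_simps power_mult[symmetric])
  finally have "has_bochner_integral lborel (\<lambda>y. normal_density 0 \<sigma> y * y ^ 4) (3 * \<sigma> ^ 4)"
    by simp
  then show ?thesis
    by (simp add: has_bochner_integral_iff nn_integral_eq_integral normal_density_nonneg)
qed

lemma nn_integral_normal_vec_fourth_moment:
  fixes i :: "'d::finite"
  assumes \<sigma>: "0 < \<sigma>"
  shows "(\<integral>\<^sup>+x. ennreal (\<Prod>k\<in>UNIV. normal_density 0 \<sigma> (x $ k)) * ennreal ((x $ i) ^ 4)
      \<partial>(lborel :: (real ^ 'd) measure)) = ennreal (3 * \<sigma> ^ 4)"
proof -
  \<comment> \<open>The fourth power is attached to the factor of coordinate \<open>i\<close> alone,
    so the integral factorises and every other coordinate contributes 1.\<close>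
  define f :: "real ^ 'd \<Rightarrow> real \<Rightarrow> real"
    where "f b y = normal_density 0 \<sigma> y * (if b = axis i 1 then y ^ 4 else 1)" for b y
  have f0: "0 \<le> f b y" for b y by (simp add: f_def normal_density_nonneg)
  have inj: "inj (\<lambda>k. axis k (1::real) :: real ^ 'd)" by (auto simp: inj_def axis_eq_axis)
  have "ennreal (\<Prod>k\<in>UNIV. normal_density 0 \<sigma> (x $ k)) * ennreal ((x $ i) ^ 4)
      = (\<Prod>b\<in>Basis. ennreal (f b (x \<bullet> b)))" for x :: "real ^ 'd"
  proof -
    have "(\<Prod>b\<in>Basis. f b (x \<bullet> b)) = (\<Prod>k\<in>UNIV. f (axis k 1) (x $ k))"
      unfolding Basis_vec_real by (subst prod.reindex[OF inj]) (simp add: inner_axis)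
    also have "\<dots> = (\<Prod>k\<in>UNIV. normal_density 0 \<sigma> (x $ k)) * (\<Prod>k\<in>UNIV. if k = i then (x $ k) ^ 4 else 1)"
      by (simp add: f_def prod.distrib axis_eq_axis)
    finally show ?thesis
      by (simp add: prod_ennreal f0 ennreal_mult[symmetric] prod_nonneg normal_density_nonneg)
  qed
  then have "(\<integral>\<^sup>+x. ennreal (\<Prod>k\<in>UNIV. normal_density 0 \<sigma> (x $ k)) * ennreal ((x $ i) ^ 4)
      \<partial>(lborel :: (real ^ 'd) measure)) = (\<integral>\<^sup>+x. (\<Prod>b\<in>Basis. ennreal (f b (x \<bullet> b))) \<partial>lborel)"
    by simp
  also have "\<dots> = (\<Prod>b\<in>Basis. (\<integral>\<^sup>+y. ennreal (f b y) \<partial>lborel))"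
    by (rule nn_integral_lborel_prod) (auto simp: f_def)
  also have "\<dots> = (\<Prod>k\<in>UNIV. (\<integral>\<^sup>+y. ennreal (f (axis k 1) y) \<partial>lborel))"
    unfolding Basis_vec_real by (subst prod.reindex[OF inj]) simp
  also have "\<dots> = (\<Prod>k\<in>UNIV. if k = i then ennreal (3 * \<sigma> ^ 4) else 1)"
  proof (rule prod.cong[OF refl])
    fix k
    have "(\<integral>\<^sup>+y. ennreal (normal_density 0 \<sigma> y) \<partial>lborel) = 1"
      using prob_space.emeasure_space_1[OF prob_space_normal_density[OF \<sigma>, of 0]]
      by (simp add: emeasure_density)
    then show "(\<integral>\<^sup>+y. ennreal (f (axis k 1) y) \<partial>lborel) = (if k = i then ennreal (3 * \<sigma> ^ 4) else 1)"
      using nn_integral_normal_fourth_moment[OF \<sigma>] by (simp add: f_def axis_eq_axis)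
  qed
  also have "\<dots> = ennreal (3 * \<sigma> ^ 4)" by simp
  finally show ?thesis .
qed

lemma norm_power4_le:
  fixes x :: "real ^ 'd"
  shows "norm x ^ 4 \<le> real CARD('d) * (\<Sum>i\<in>UNIV. (x $ i) ^ 4)"
proof -
  have "norm x ^ 4 = ((norm x)\<^sup>2)\<^sup>2" by (simp add: power_mult[symmetric])
  also have "(norm x)\<^sup>2 = (\<Sum>i\<in>UNIV. (x $ i)\<^sup>2)"
    by (simp add: norm_vec_def L2_set_def sum_nonneg)
  also have "(\<Sum>i\<in>UNIV. (x $ i)\<^sup>2)\<^sup>2 \<le> (\<Sum>i\<in>UNIV. ((x $ i)\<^sup>2)\<^sup>2) * card (UNIV :: 'd set)"
    by (rule sum_squared_le_sum_of_squares)
  finally show ?thesis by (simp add: power_mult[symmetric] mult.commute)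
qed

text \<open>Dyadic chaining with ratio \<open>9/10\<close>: the increments at level \<open>n\<close> are allowed to be of size
  \<open>\<eta>/10 (9/10)\<^sup>n\<close>, which sums to \<open>\<eta>\<close>.\<close>

lemma dyadic_chaining:
  fixes v :: "real \<Rightarrow> real"
  assumes cont: "continuous_on {s..s + \<Delta>} v" and "0 \<le> \<Delta>" "v s = 0"
    and incr: "\<And>n i. i < 2 ^ n \<Longrightarrow>
      \<bar>v (s + \<Delta> * (real (Suc i) / 2 ^ n)) - v (s + \<Delta> * (real i / 2 ^ n))\<bar> < \<eta> / 10 * (9 / 10) ^ n"
    and t: "t \<in> {s..s + \<Delta>}"
  shows "\<bar>v t\<bar> \<le> \<eta>"
proof -
  have \<eta>: "0 < \<eta>" using le_less_trans[OF abs_ge_zero incr[of 0 0]] by simp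
  \<comment> \<open>The bound is the sum of the allowances of levels 0 to \<open>n\<close>, a
    partial geometric sum.\<close>
  have dy: "\<bar>v (s + \<Delta> * (real i / 2 ^ n))\<bar> \<le> \<eta> * (1 - (9 / 10) ^ Suc n)" if "i \<le> 2 ^ n" for i n
    using that
  proof (induction n arbitrary: i)
    case 0
    then consider "i = 0" | "i = 1" by force
    then show ?case using incr[of 0 0] \<open>v s = 0\<close> \<eta> by cases auto
  next
    case (Suc n)
    have even: "\<bar>v (s + \<Delta> * (real (2 * k) / 2 ^ Suc n))\<bar> \<le> \<eta> * (1 - (9 / 10) ^ Suc n)" if "k \<le> 2 ^ n" for k
      using Suc.IH[OF that] by simp
    show ?case
    proof (cases "even i")
      case True
      then obtain k where k: "i = 2 * k" by blast
      have "\<eta> * (1 - (9 / 10) ^ Suc n) \<le> \<eta> * (1 - (9 / 10) ^ Suc (Suc n))"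
        using \<eta> by (intro mult_left_mono) auto
      moreover have "k \<le> 2 ^ n" using k Suc.prems by simp
      ultimately show ?thesis using even[of k] unfolding k by linarith
    next
      case False
      \<comment> \<open>An odd grid point is one increment of the new level away from its left
        neighbour, which belongs to the previous grid.\<close>
      then obtain k where k: "i = Suc (2 * k)" by (auto elim: oddE)
      have "\<bar>v (s + \<Delta> * (real i / 2 ^ Suc n))\<bar> \<le> \<eta> * (1 - (9 / 10) ^ Suc n) + \<eta> / 10 * (9 / 10) ^ Suc n"
      proof -
        have "2 * k < 2 ^ Suc n" using Suc.prems unfolding k by simp
        moreover have "k \<le> 2 ^ n" using Suc.prems unfolding k by simp
        ultimately show ?thesis
          using even[of k] incr[of "2 * k" "Suc n"] unfolding k by linarith
      qed
      also have "\<dots> = \<eta> * (1 - (9 / 10) ^ Suc (Suc n))" by (simp add: field_simps)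
      finally show ?thesis .
    qed
  qed
  define x where "x = (if \<Delta> = 0 then 0 else (t - s) / \<Delta>)"
  have x: "0 \<le> x" "x \<le> 1" "t = s + \<Delta> * x"
    using t \<open>0 \<le> \<Delta>\<close> by (auto simp: x_def field_simps)
  have lim: "(\<lambda>n. real (nat \<lfloor>2 ^ n * x\<rfloor>) / 2 ^ n) \<longlonglongrightarrow> x"
    using x(1)
    by (rule floor_grid_tendsto)
      (auto intro!: filterlim_at_top_mono[OF filterlim_real_sequentially] always_eventually
        less_imp_le of_nat_less_two_power)
  have le: "nat \<lfloor>2 ^ n * x\<rfloor> \<le> 2 ^ n" for n
  proof -
    have "2 ^ n * x \<le> 2 ^ n" using x by (simp add: mult_left_le)
    then have "\<lfloor>2 ^ n * x\<rfloor> \<le> \<lfloor>2 ^ n :: real\<rfloor>" by (rule floor_mono)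
    then show ?thesis by (simp add: nat_le_iff)
  qed
  have "(\<lambda>n. v (s + \<Delta> * (real (nat \<lfloor>2 ^ n * x\<rfloor>) / 2 ^ n))) \<longlonglongrightarrow> v t"
  proof (rule continuous_on_tendsto_compose[OF cont])
    show "(\<lambda>n. s + \<Delta> * (real (nat \<lfloor>2 ^ n * x\<rfloor>) / 2 ^ n)) \<longlonglongrightarrow> t"
      unfolding x(3) by (intro tendsto_intros lim)
    have "real (nat \<lfloor>2 ^ n * x\<rfloor>) / 2 ^ n \<le> 1" for n
      using of_nat_mono[OF le[of n], where 'a=real] by (simp add: divide_le_eq_1)
    then have "\<Delta> * (real (nat \<lfloor>2 ^ n * x\<rfloor>) / 2 ^ n) \<le> \<Delta> * 1" for n
      using \<open>0 \<le> \<Delta>\<close> by (intro mult_left_mono)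
    then show "\<forall>\<^sub>F n in sequentially. s + \<Delta> * (real (nat \<lfloor>2 ^ n * x\<rfloor>) / 2 ^ n) \<in> {s..s + \<Delta>}"
      using \<open>0 \<le> \<Delta>\<close> by auto
  qed (use t in auto)
  then have "(\<lambda>n. \<bar>v (s + \<Delta> * (real (nat \<lfloor>2 ^ n * x\<rfloor>) / 2 ^ n))\<bar>) \<longlonglongrightarrow> \<bar>v t\<bar>"
    by (rule tendsto_rabs)
  moreover have "\<bar>v (s + \<Delta> * (real (nat \<lfloor>2 ^ n * x\<rfloor>) / 2 ^ n))\<bar> \<le> \<eta>" for n
  proof -
    have "\<eta> * (1 - (9 / 10) ^ Suc n) \<le> \<eta> * 1" using \<eta> by (intro mult_left_mono) auto
    then show ?thesis using dy[OF le[of n]] by linarith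
  qed
  ultimately show ?thesis by (intro LIMSEQ_le_const2) auto
qed

section \<open>Moments, tails and maxima of Brownian increments\<close>

context brownian_space
begin

text \<open>The 3 is the Gaussian fourth moment. One factor \<open>CARD('d)\<close> comes from the
  Cauchy-Schwarz inequality in \<open>norm_power4_le\<close>, the other from summing over the
  coordinates.\<close>

lemma W_fourth_moment:
  assumes st: "0 \<le> s" "s \<le> t" "t \<le> T"
  shows "(\<integral>\<^sup>+\<omega>. ennreal (norm (W t \<omega> - W s \<omega>) ^ 4) \<partial>M) \<le> ennreal (3 * (real CARD('d))\<^sup>2 * (t - s)\<^sup>2)"
proof (cases "s = t")
  case False
  then have "s < t" using st by simp
  then have D: "distributed M lborel (\<lambda>\<omega>. B t \<omega> - B s \<omega>)
      (\<lambda>x. ennreal (\<Prod>i\<in>UNIV. normal_density 0 (sqrt (t - s)) (x $ i)))"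
    using standard_BM st unfolding standard_brownian_motion_def by blast
  have moment: "(\<integral>\<^sup>+\<omega>. ennreal (((B t \<omega> - B s \<omega>) $ i) ^ 4) \<partial>M) = ennreal (3 * (t - s)\<^sup>2)" for i
  proof -
    have "sqrt (t - s) ^ 4 = (t - s)\<^sup>2"
      using \<open>s < t\<close> power_mult[of "sqrt (t - s)" 2 2] by simp
    then show ?thesis
      using distributed_nn_integral[OF D, of "\<lambda>x. ennreal ((x $ i) ^ 4)"] \<open>s < t\<close>
        nn_integral_normal_vec_fourth_moment[of "sqrt (t - s)" i] by simp
  qed
  have [measurable]: "B t \<in> borel_measurable M" "B s \<in> borel_measurable M"
    using st by (auto intro: B_measurable)
  have "(\<integral>\<^sup>+\<omega>. ennreal (norm (W t \<omega> - W s \<omega>) ^ 4) \<partial>M) = (\<integral>\<^sup>+\<omega>. ennreal (norm (B t \<omega> - B s \<omega>) ^ 4) \<partial>M)"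
    using AE_regular by (intro nn_integral_cong_AE) (auto elim!: eventually_mono simp: W_eq)
  also have "\<dots> \<le> (\<integral>\<^sup>+\<omega>. ennreal (real CARD('d)) * (\<Sum>i\<in>UNIV. ennreal (((B t \<omega> - B s \<omega>) $ i) ^ 4)) \<partial>M)"
    using norm_power4_le
    by (intro nn_integral_mono)
      (simp add: ennreal_mult[symmetric] sum_ennreal sum_nonneg ennreal_leI del: vector_minus_component)
  also have "\<dots> = ennreal (real CARD('d)) * (\<Sum>i\<in>(UNIV :: 'd set). ennreal (3 * (t - s)\<^sup>2))"
  proof -
    have [measurable]: "(\<lambda>\<omega>. ennreal (((B t \<omega> - B s \<omega>) $ i) ^ 4)) \<in> borel_measurable M" for i
      unfolding cart_eq_inner_axis by measurable
    show ?thesis by (subst nn_integral_cmult, measurable, subst nn_integral_sum) (simp_all only: moment, measurable)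
  qed
  also have "\<dots> = ennreal (3 * (real CARD('d))\<^sup>2 * (t - s)\<^sup>2)"
    by (simp add: ennreal_of_nat_eq_real_of_nat power2_eq_square[of "real CARD('d)"] ac_simps
        flip: ennreal_mult)
  finally show ?thesis .
qed simp

lemma W_increment_tail:
  assumes st: "0 \<le> s" "s \<le> t" "t \<le> T" and c: "0 < c"
  shows "emeasure M {\<omega> \<in> space M. c \<le> \<bar>z \<bullet> (W t \<omega> - W s \<omega>)\<bar>}
    \<le> ennreal (3 * (real CARD('d))\<^sup>2 * norm z ^ 4 * (t - s)\<^sup>2 / c ^ 4)"
proof -
  have [measurable]: "W t \<in> borel_measurable M" "W s \<in> borel_measurable M"
    using st by (auto intro: continuous_adapted_measurable[OF continuous_adapted_W])
  have "emeasure M {\<omega> \<in> space M. c \<le> \<bar>z \<bullet> (W t \<omega> - W s \<omega>)\<bar>}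
     = (\<integral>\<^sup>+\<omega>. indicator {\<omega> \<in> space M. c \<le> \<bar>z \<bullet> (W t \<omega> - W s \<omega>)\<bar>} \<omega> \<partial>M)"
    by (rule nn_integral_indicator[symmetric]) measurable
  also have "\<dots> \<le> (\<integral>\<^sup>+\<omega>. ennreal (norm z ^ 4 / c ^ 4) * ennreal (norm (W t \<omega> - W s \<omega>) ^ 4) \<partial>M)"
  proof (rule nn_integral_mono)
    fix \<omega>
    show "indicator {\<omega> \<in> space M. c \<le> \<bar>z \<bullet> (W t \<omega> - W s \<omega>)\<bar>} \<omega>
      \<le> ennreal (norm z ^ 4 / c ^ 4) * ennreal (norm (W t \<omega> - W s \<omega>) ^ 4)"
    proof (cases "c \<le> \<bar>z \<bullet> (W t \<omega> - W s \<omega>)\<bar>")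
      case True
      then have "c \<le> norm z * norm (W t \<omega> - W s \<omega>)"
        using Cauchy_Schwarz_ineq2[of z "W t \<omega> - W s \<omega>"] by linarith
      then have "c ^ 4 \<le> (norm z * norm (W t \<omega> - W s \<omega>)) ^ 4"
        using c by (intro power_mono) auto
      then have "1 \<le> norm z ^ 4 / c ^ 4 * norm (W t \<omega> - W s \<omega>) ^ 4"
        using c by (simp add: field_simps power_mult_distrib)
      then show ?thesis
        using c by (simp add: indicator_def ennreal_mult[symmetric] ennreal_1[symmetric] ennreal_leI del: ennreal_1)
    qed simp
  qed
  also have "\<dots> = ennreal (norm z ^ 4 / c ^ 4) * (\<integral>\<^sup>+\<omega>. ennreal (norm (W t \<omega> - W s \<omega>) ^ 4) \<partial>M)"
    by (rule nn_integral_cmult) measurable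
  also have "\<dots> \<le> ennreal (norm z ^ 4 / c ^ 4) * ennreal (3 * (real CARD('d))\<^sup>2 * (t - s)\<^sup>2)"
    by (intro mult_left_mono W_fourth_moment st) simp
  also have "\<dots> = ennreal (3 * (real CARD('d))\<^sup>2 * norm z ^ 4 * (t - s)\<^sup>2 / c ^ 4)"
    using c by (simp add: ennreal_mult[symmetric] ac_simps)
  finally show ?thesis .
qed

text \<open>A union bound over all dyadic increments; \<open>E\<close> collects those exceeding
  their allowance, and chaining controls every path outside it. The bound depends on
  \<open>z\<close> and \<open>\<Delta>\<close> only through the variance
  \<open>(norm z)\<^sup>2 * \<Delta>\<close>, which is small when the drift
  \<open>g z * \<Delta>\<close> is fixed and \<open>g z / (norm z)\<^sup>2\<close> is large.\<close>

lemma W_maximal_inequality: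
  "\<exists>K\<ge>0. \<forall>s \<Delta> \<eta> z. 0 \<le> s \<longrightarrow> 0 \<le> \<Delta> \<longrightarrow> s + \<Delta> \<le> T \<longrightarrow> 0 < \<eta> \<longrightarrow>
    (\<exists>E\<in>sets M. emeasure M E \<le> ennreal (K * ((norm z)\<^sup>2 * \<Delta>)\<^sup>2 / \<eta> ^ 4) \<and>
      (\<forall>\<omega>\<in>space M - E. \<forall>t\<in>{s..s + \<Delta>}. \<bar>z \<bullet> (W t \<omega> - W s \<omega>)\<bar> \<le> \<eta>))"
proof -
  \<comment> \<open>At level \<open>n\<close> there are \<open>2 ^ n\<close> increments, the squared
    step length contributes \<open>1 / 4 ^ n\<close>, and the fourth power of the allowance divides
    by \<open>(9 / 10) ^ (4 * n)\<close>. The resulting ratio is about 0.76; second moments would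
    give a ratio above 1, hence the fourth.\<close>
  define \<rho> :: real where "\<rho> = 1 / (2 * (9 / 10) ^ 4)"
  define K where "K = 3 * (real CARD('d))\<^sup>2 * 10 ^ 4 * (1 / (1 - \<rho>))"
  have \<rho>: "0 \<le> \<rho>" "\<rho> < 1" by (simp_all add: \<rho>_def field_simps)
  have "\<exists>E\<in>sets M. emeasure M E \<le> ennreal (K * ((norm z)\<^sup>2 * \<Delta>)\<^sup>2 / \<eta> ^ 4) \<and>
      (\<forall>\<omega>\<in>space M - E. \<forall>t\<in>{s..s + \<Delta>}. \<bar>z \<bullet> (W t \<omega> - W s \<omega>)\<bar> \<le> \<eta>)"
    if s\<Delta>: "0 \<le> s" "0 \<le> \<Delta>" "s + \<Delta> \<le> T" and \<eta>: "0 < \<eta>" for s \<Delta> \<eta> z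
  proof -
    define p where "p n i = s + \<Delta> * (real i / 2 ^ n)" for n i
    have p: "p n i \<in> {0..T}" "p n i \<in> {s..s + \<Delta>}" if "i \<le> 2 ^ n" for n i
    proof -
      have "real i / 2 ^ n \<le> 1" using of_nat_mono[OF that, where 'a=real] by (simp add: divide_le_eq_1)
      then have "\<Delta> * (real i / 2 ^ n) \<le> \<Delta> * 1" using s\<Delta> by (intro mult_left_mono)
      then show "p n i \<in> {0..T}" "p n i \<in> {s..s + \<Delta>}" using s\<Delta> unfolding p_def by auto
    qed
    define c where "c n = \<eta> / 10 * (9 / 10) ^ n" for n :: nat
    have c: "0 < c n" for n using \<eta> by (simp add: c_def)
    define A where "A n i = {\<omega> \<in> space M. c n \<le> \<bar>z \<bullet> (W (p n (Suc i)) \<omega> - W (p n i) \<omega>)\<bar>}" for n i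
    have A: "A n i \<in> sets M" if "i < 2 ^ n" for n i
    proof -
      have [measurable]: "W (p n (Suc i)) \<in> borel_measurable M" "W (p n i) \<in> borel_measurable M"
        using that p[of "Suc i" n] p[of i n] by (auto intro!: continuous_adapted_measurable[OF continuous_adapted_W])
      show ?thesis unfolding A_def by measurable
    qed
    define E where "E = (\<Union>n. \<Union>i<2 ^ n. A n i)"
    define a where "a = 3 * (real CARD('d))\<^sup>2 * norm z ^ 4 * \<Delta>\<^sup>2 * 10 ^ 4 / \<eta> ^ 4"
    have level: "emeasure M (\<Union>i<2 ^ n. A n i) \<le> ennreal (a * \<rho> ^ n)" for n
    proof -
      have "emeasure M (\<Union>i<2 ^ n. A n i) \<le> (\<Sum>i<(2::nat) ^ n. emeasure M (A n i))"
        using A by (intro emeasure_subadditive_finite) auto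
      also have "\<dots> \<le> (\<Sum>i<(2::nat) ^ n. ennreal (a * \<rho> ^ n / 2 ^ n))"
      proof (rule sum_mono)
        fix i :: nat assume "i \<in> {..<2 ^ n}"
        then have i: "i < 2 ^ n" by simp
        have incr: "p n (Suc i) - p n i = \<Delta> / 2 ^ n" by (simp add: p_def field_simps)
        moreover have "0 \<le> \<Delta> / 2 ^ n" using s\<Delta> by simp
        ultimately have "p n i \<le> p n (Suc i)" by linarith
        then have "emeasure M (A n i) \<le>
            ennreal (3 * (real CARD('d))\<^sup>2 * norm z ^ 4 * (p n (Suc i) - p n i)\<^sup>2 / c n ^ 4)"
          unfolding A_def using p[of "Suc i" n] p[of i n] i c by (intro W_increment_tail) auto
        also have "3 * (real CARD('d))\<^sup>2 * norm z ^ 4 * (p n (Suc i) - p n i)\<^sup>2 / c n ^ 4 = a * \<rho> ^ n / 2 ^ n"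
        proof -
          define q :: real where "q = ((9 / 10) ^ 4) ^ n"
          have c4: "c n ^ 4 = \<eta> ^ 4 / 10 ^ 4 * q"
            unfolding c_def q_def by (simp only: power_mult_distrib power_divide power_mult[symmetric] mult.commute)
          have \<rho>n: "\<rho> ^ n = 1 / (2 ^ n * q)"
            unfolding \<rho>_def q_def by (simp only: power_divide power_mult_distrib power_one)
          have "0 < q" by (simp add: q_def)
          then show ?thesis
            unfolding incr a_def c4 \<rho>n using \<eta> by (simp add: field_simps power2_eq_square)
        qed
        finally show "emeasure M (A n i) \<le> ennreal (a * \<rho> ^ n / 2 ^ n)" .
      qed
      also have "\<dots> = ennreal (a * \<rho> ^ n)"
        by (simp add: ennreal_of_nat_eq_real_of_nat ennreal_mult'[symmetric])
      finally show ?thesis .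
    qed
    have a0: "0 \<le> a" using \<eta> by (simp add: a_def)
    have "emeasure M E \<le> (\<Sum>n. emeasure M (\<Union>i<2 ^ n. A n i))"
      unfolding E_def using A by (intro emeasure_subadditive_countably) auto
    also have "\<dots> \<le> (\<Sum>n. ennreal (a * \<rho> ^ n))"
      by (intro suminf_le level summableI)
    also have "\<dots> = ennreal (a * (1 / (1 - \<rho>)))"
      using a0 \<rho> by (intro suminf_ennreal_eq sums_mult geometric_sums) auto
    also have "a * (1 / (1 - \<rho>)) = K * ((norm z)\<^sup>2 * \<Delta>)\<^sup>2 / \<eta> ^ 4"
      by (simp add: a_def K_def power_mult_distrib power_mult[symmetric] ac_simps)
    finally have "emeasure M E \<le> ennreal (K * ((norm z)\<^sup>2 * \<Delta>)\<^sup>2 / \<eta> ^ 4)" .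
    moreover have "\<bar>z \<bullet> (W t \<omega> - W s \<omega>)\<bar> \<le> \<eta>" if \<omega>: "\<omega> \<in> space M - E" and t: "t \<in> {s..s + \<Delta>}" for \<omega> t
    proof (rule dyadic_chaining[where v="\<lambda>t. z \<bullet> (W t \<omega> - W s \<omega>)", OF _ s\<Delta>(2) _ _ t])
      have "continuous_on {s..s + \<Delta>} (\<lambda>t. W t \<omega>)"
        by (rule continuous_on_subset[OF continuous_adapted_paths[OF continuous_adapted_W]]) (use \<omega> s\<Delta> in auto)
      then show "continuous_on {s..s + \<Delta>} (\<lambda>t. z \<bullet> (W t \<omega> - W s \<omega>))" by (intro continuous_intros)
      fix n i :: nat assume "i < 2 ^ n"
      then have "\<omega> \<notin> A n i" using \<omega> unfolding E_def by auto
      then have "\<bar>z \<bullet> (W (p n (Suc i)) \<omega> - W (p n i) \<omega>)\<bar> < c n" using \<omega> unfolding A_def by auto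
      then show "\<bar>z \<bullet> (W (s + \<Delta> * (real (Suc i) / 2 ^ n)) \<omega> - W s \<omega>) -
         z \<bullet> (W (s + \<Delta> * (real i / 2 ^ n)) \<omega> - W s \<omega>)\<bar> < \<eta> / 10 * (9 / 10) ^ n"
        unfolding p_def c_def by (simp only: inner_diff_right diff_diff_eq2 diff_add_cancel)
    qed simp
    moreover have "E \<in> sets M" unfolding E_def using A by (intro sets.countable_UN sets.finite_UN) auto
    ultimately show ?thesis by blast
  qed
  moreover have "0 \<le> K" using \<rho> by (simp add: K_def)
  ultimately show ?thesis by blast
qed

end

section \<open>Solutions that rise to 1 in a short time\<close>

text \<open>The length of the intersection is expressed through \<open>min\<close> to match the form
  of the drift in \<open>Yn_increment\<close>.\<close>

lemma set_lebesgue_integral_indicator_Ioc: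
  fixes a b t T c :: real
  assumes "a \<le> b" "b \<le> T" "t \<le> T"
  shows "set_integrable lborel {t..T} (\<lambda>s. c * indicator {a<..b} s)"
    and "(LINT s:{t..T}|lborel. c * indicator {a<..b} s) = c * ((b - a) - (min t b - min t a))"
proof -
  \<comment> \<open>For \<open>a < t\<close> the interval \<open>{t..b}\<close> is empty when the
    block ends before \<open>t\<close>.\<close>
  define S where "S = (if t \<le> a then {a<..b} else {t..b})"
  have S: "indicator {t..T} s *\<^sub>R (c * indicator {a<..b} s) = c * (indicator S s :: real)" for s
    using assms by (auto simp: S_def indicator_def)
  have "emeasure lborel S < \<infinity>" using assms(1) by (simp add: S_def emeasure_lborel_Icc_eq)
  then show "set_integrable lborel {t..T} (\<lambda>s. c * indicator {a<..b} s)"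
    unfolding set_integrable_def S by (intro integrable_mult_right integrable_real_indicator) (auto simp: S_def)
  have "measure lborel S = (b - a) - (min t b - min t a)"
    using assms by (auto simp: S_def min_def)
  then show "(LINT s:{t..T}|lborel. c * indicator {a<..b} s) = c * ((b - a) - (min t b - min t a))"
    unfolding set_lebesgue_integral_def S by simp
qed

section \<open>Closure properties of continuous adapted processes\<close>

context brownian_space
begin

lemma continuous_adapted_const: "continuous_adapted (\<lambda>_ _. c)"
  unfolding continuous_adapted_def by (auto intro: continuous_intros)

lemma continuous_adapted_time: "continuous_on {0..T} f \<Longrightarrow> continuous_adapted (\<lambda>t _. f t)"
  unfolding continuous_adapted_def by auto

lemma continuous_adapted_compose:
  fixes X :: "real \<Rightarrow> 'w \<Rightarrow> 'b::topological_space" and h :: "'b \<Rightarrow> 'c::topological_space"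
  assumes X: "continuous_adapted X" and h: "continuous_on UNIV h"
  shows "continuous_adapted (\<lambda>t \<omega>. h (X t \<omega>))"
  using X unfolding continuous_adapted_def
  by (auto intro!: measurable_compose[OF _ borel_measurable_continuous_onI[OF h]]
      continuous_on_compose2[OF h])

lemma continuous_adapted_add:
  fixes X Y :: "real \<Rightarrow> 'w \<Rightarrow> 'b::{second_countable_topology, topological_monoid_add}"
  shows "continuous_adapted X \<Longrightarrow> continuous_adapted Y \<Longrightarrow> continuous_adapted (\<lambda>t \<omega>. X t \<omega> + Y t \<omega>)"
  unfolding continuous_adapted_def by (auto intro!: continuous_on_add borel_measurable_add)

lemma continuous_adapted_diff:
  fixes X Y :: "real \<Rightarrow> 'w \<Rightarrow> 'b::{second_countable_topology, real_normed_vector}"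
  shows "continuous_adapted X \<Longrightarrow> continuous_adapted Y \<Longrightarrow> continuous_adapted (\<lambda>t \<omega>. X t \<omega> - Y t \<omega>)"
  unfolding continuous_adapted_def by (auto intro!: continuous_on_diff borel_measurable_diff)

lemma continuous_adapted_min:
  fixes X Y :: "real \<Rightarrow> 'w \<Rightarrow> real"
  shows "continuous_adapted X \<Longrightarrow> continuous_adapted Y \<Longrightarrow> continuous_adapted (\<lambda>t \<omega>. min (X t \<omega>) (Y t \<omega>))"
  unfolding continuous_adapted_def by (auto intro!: continuous_on_min borel_measurable_min)

lemma continuous_adapted_cmult:
  fixes X :: "real \<Rightarrow> 'w \<Rightarrow> real"
  shows "continuous_adapted X \<Longrightarrow> continuous_adapted (\<lambda>t \<omega>. c * X t \<omega>)"
  by (rule continuous_adapted_compose) (auto intro!: continuous_intros)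

lemma continuous_adapted_inner:
  fixes X :: "real \<Rightarrow> 'w \<Rightarrow> 'b::real_inner"
  shows "continuous_adapted X \<Longrightarrow> continuous_adapted (\<lambda>t \<omega>. c \<bullet> X t \<omega>)"
  by (rule continuous_adapted_compose) (auto intro!: continuous_intros)

end

text \<open>The drift available in a block suffices even from the lowest level
  \<open>y - \<epsilon>\<close> against noise of size \<epsilon>. The probabilities of the sets
  \<open>E j\<close> tend to 0, so failures cannot go on forever, and they are summable, so the
  expected drift is finite.\<close>

locale upward_jump = brownian_space M T B
  for M :: "'w measure" and T :: real and B :: "real \<Rightarrow> 'w \<Rightarrow> real ^ 'd" +
  fixes g :: "real ^ 'd \<Rightarrow> real" and y \<epsilon> e :: real
    and \<tau> :: "nat \<Rightarrow> real" and z :: "nat \<Rightarrow> real ^ 'd" and E :: "nat \<Rightarrow> 'w set"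
  assumes g_nonneg: "\<And>x. 0 \<le> g x" and g_zero: "g 0 = 0"
    and y: "y < 1" and \<epsilon>: "0 < \<epsilon>"
    and \<tau>: "\<And>j. \<tau> j < \<tau> (Suc j)" "0 \<le> \<tau> 0" "\<And>j. \<tau> j \<le> e" "e \<le> T"
    and drift: "\<And>j. g (z j) * (\<tau> (Suc j) - \<tau> j) = 1 - y + 2 * \<epsilon>"
    and E: "\<And>j. E j \<in> sets M" "\<And>j. emeasure M (E j) \<le> ennreal ((1 / 2) ^ j)"
    and noise: "\<And>j \<omega> t. \<omega> \<in> space M \<Longrightarrow> \<omega> \<notin> E j \<Longrightarrow> t \<in> {\<tau> j..\<tau> (Suc j)} \<Longrightarrow>
      \<bar>z j \<bullet> (W t \<omega> - W (\<tau> j) \<omega>)\<bar> \<le> \<epsilon> / 2 ^ (j + 2)"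
begin

text \<open>The barriers descend from \<open>y\<close> towards \<open>y - \<epsilon>\<close>. The
  step from \<open>L j\<close> to \<open>L (Suc j)\<close> is twice the noise permitted in block
  \<open>j\<close>, so a block with permitted noise cannot reach the lower barrier.\<close>

definition L :: "nat \<Rightarrow> real" where
  "L j = y - \<epsilon> + \<epsilon> / 2 ^ j"

text \<open>The truncation \<open>min t (\<tau> j)\<close> keeps \<open>V j X\<close> adapted at the times before \<open>\<tau> j\<close>.\<close>

definition V :: "nat \<Rightarrow> (real \<Rightarrow> 'w \<Rightarrow> real) \<Rightarrow> real \<Rightarrow> 'w \<Rightarrow> real" where
  "V j X t \<omega> = X t \<omega> + g (z j) * (t - min t (\<tau> j)) - z j \<bullet> (W t \<omega> - W (min t (\<tau> j)) \<omega>)"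

text \<open>Turns the exit of \<open>V j X\<close> from an open interval with two ends into the
  hitting of the nonpositive half-line.\<close>

definition margin :: "nat \<Rightarrow> (real \<Rightarrow> 'w \<Rightarrow> real) \<Rightarrow> real \<Rightarrow> 'w \<Rightarrow> real" where
  "margin j X t \<omega> = min (V j X t \<omega> - L (Suc j)) (1 - V j X t \<omega>)"

text \<open>The process after \<open>n\<close> blocks have been run; it is frozen once block
  \<open>n - 1\<close> has stopped, which lets the next block be added on top of it.\<close>

primrec Yn :: "nat \<Rightarrow> real \<Rightarrow> 'w \<Rightarrow> real" where
  "Yn 0 = (\<lambda>_ _. y)"
| "Yn (Suc j) = (\<lambda>t \<omega>. V j (Yn j) (min t (hitting (margin j (Yn j)) (\<tau> j) (\<tau> (Suc j)) \<omega>)) \<omega>)"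

definition \<sigma> :: "nat \<Rightarrow> 'w \<Rightarrow> real" where
  "\<sigma> j = hitting (margin j (Yn j)) (\<tau> j) (\<tau> (Suc j))"

lemma Yn_Suc: "Yn (Suc j) t \<omega> = V j (Yn j) (min t (\<sigma> j \<omega>)) \<omega>"
  by (simp add: \<sigma>_def)

declare Yn.simps(2) [simp del]

lemma \<tau>_mono: "i \<le> j \<Longrightarrow> \<tau> i \<le> \<tau> j"
  by (rule lift_Suc_mono_le[of \<tau>, OF less_imp_le[OF \<tau>(1)]])

lemma \<tau>_range: "\<tau> j \<in> {0..T}"
  using \<tau>_mono[of 0 j] \<tau>(2,4) \<tau>(3)[of j] by auto

lemma \<sigma>_bounds: "\<tau> j \<le> \<sigma> j \<omega>" "\<sigma> j \<omega> \<le> \<tau> (Suc j)"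
  using hitting_bounds[of "\<tau> j" "\<tau> (Suc j)"] \<tau>(1)[of j] unfolding \<sigma>_def by auto

lemma continuous_adapted_margin:
  assumes "continuous_adapted X"
  shows "continuous_adapted (V j X)" "continuous_adapted (margin j X)"
proof -
  have "continuous_adapted (\<lambda>t \<omega>. W (min t (\<tau> j)) \<omega>)"
    by (rule continuous_adapted_stopped[OF continuous_adapted_W stopping_const[OF \<tau>_range]])
  then show V: "continuous_adapted (V j X)"
    unfolding V_def[abs_def]
    by (intro continuous_adapted_diff continuous_adapted_add assms continuous_adapted_cmult continuous_adapted_inner continuous_adapted_W continuous_adapted_time
        continuous_intros)
  show "continuous_adapted (margin j X)"
    unfolding margin_def[abs_def] by (intro continuous_adapted_min continuous_adapted_diff V continuous_adapted_const)
qed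

lemma continuous_adapted_Yn: "continuous_adapted (Yn n)"
proof (induction n)
  case 0
  then show ?case by (simp add: continuous_adapted_const)
next
  case (Suc j)
  have "stopping (\<sigma> j)"
    unfolding \<sigma>_def using \<tau>_range[of j] \<tau>_range[of "Suc j"] \<tau>(1)[of j]
    by (intro stopping_hitting continuous_adapted_margin Suc) auto
  then have "continuous_adapted (\<lambda>t \<omega>. V j (Yn j) (min t (\<sigma> j \<omega>)) \<omega>)"
    by (intro continuous_adapted_stopped continuous_adapted_margin Suc)
  then show ?case unfolding Yn_Suc[abs_def] by (simp add: Yn_Suc[abs_def])
qed

lemma stopping_\<sigma>: "stopping (\<sigma> j)"
  unfolding \<sigma>_def using \<tau>_range[of j] \<tau>_range[of "Suc j"] \<tau>(1)[of j]
  by (intro stopping_hitting continuous_adapted_margin continuous_adapted_Yn) auto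

lemma Yn_stopped: "Yn n (min t (\<tau> n)) \<omega> = Yn n t \<omega>"
proof (cases n)
  case (Suc j)
  have "min (min t (\<tau> (Suc j))) (\<sigma> j \<omega>) = min t (\<sigma> j \<omega>)"
    using \<sigma>_bounds(2)[of j \<omega>] by (simp add: min_def)
  then show ?thesis unfolding Suc Yn_Suc by (simp only:)
qed simp

text \<open>\<open>Yn j\<close> is frozen from \<open>\<tau> j\<close> on, and
  \<open>\<sigma> j \<omega>\<close> is not earlier, so stopping \<open>Yn j\<close> there leaves it
  unchanged.\<close>

lemma Yn_increment:
  "Yn (Suc j) t \<omega> = Yn j t \<omega> + g (z j) * (min t (\<sigma> j \<omega>) - min t (\<tau> j))
    - z j \<bullet> (W (min t (\<sigma> j \<omega>)) \<omega> - W (min t (\<tau> j)) \<omega>)"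
proof -
  have *: "min (min t (\<sigma> j \<omega>)) (\<tau> j) = min t (\<tau> j)"
    using \<sigma>_bounds(1)[of j \<omega>] by (simp add: min_def)
  have "Yn j (min t (\<sigma> j \<omega>)) \<omega> = Yn j t \<omega>"
    using Yn_stopped[of j "min t (\<sigma> j \<omega>)" \<omega>] Yn_stopped[of j t \<omega>] unfolding * by simp
  then show ?thesis unfolding Yn_Suc V_def * by simp
qed

lemma L_Suc: "L j - L (Suc j) = 2 * (\<epsilon> / 2 ^ (j + 2))"
  by (simp add: L_def)

lemma Yn_sum:
  "Yn n t \<omega> = y + (\<Sum>j<n. g (z j) * (min t (\<sigma> j \<omega>) - min t (\<tau> j)))
    - (\<Sum>j<n. z j \<bullet> (W (min t (\<sigma> j \<omega>)) \<omega> - W (min t (\<tau> j)) \<omega>))"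
  by (induction n) (simp_all add: Yn_increment)

lemma V_before: "t \<le> \<tau> j \<Longrightarrow> V j X t \<omega> = X t \<omega>"
  by (simp add: V_def min_def)

lemma margin_nonneg_iff: "0 \<le> margin j X t \<omega> \<longleftrightarrow> L (Suc j) \<le> V j X t \<omega> \<and> V j X t \<omega> \<le> 1"
  by (auto simp: margin_def)

lemma margin_continuous:
  assumes "\<omega> \<in> space M"
  shows "continuous_on {\<tau> j..\<tau> (Suc j)} (\<lambda>t. margin j (Yn j) t \<omega>)"
  by (rule continuous_on_subset[OF continuous_adapted_paths[OF continuous_adapted_margin(2)[OF continuous_adapted_Yn] assms]])
    (use \<tau>_range[of j] \<tau>_range[of "Suc j"] in auto)

text \<open>Block \<open>j\<close> starts between \<open>L j\<close> and 1, hence with nonnegative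
  margin since \<open>L (Suc j)\<close> is lower; the margin stays nonnegative until the exit time.
  It can vanish at the start, when level 1 has been reached already.\<close>

lemma Yn_bounds:
  assumes \<omega>: "\<omega> \<in> space M"
  shows "L n \<le> Yn n t \<omega> \<and> Yn n t \<omega> \<le> 1"
proof (induction n arbitrary: t)
  case 0
  then show ?case using y by (simp add: L_def)
next
  case (Suc j)
  have "0 < \<epsilon> / 2 ^ (j + 2)" using \<epsilon> by simp
  then have L: "L (Suc j) \<le> L j" using L_Suc[of j] by linarith
  show ?case
  proof (cases "t \<le> \<tau> j")
    case True
    then have "Yn (Suc j) t \<omega> = Yn j t \<omega>"
      using \<sigma>_bounds(1)[of j \<omega>] by (simp add: Yn_Suc V_before min_def)
    then show ?thesis using Suc[of t] L by simp
  next
    case False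
    have "0 \<le> margin j (Yn j) (min t (\<sigma> j \<omega>)) \<omega>"
      unfolding \<sigma>_def
    proof (rule nonneg_until_hitting[where X="margin j (Yn j)", OF margin_continuous[OF \<omega>]])
      show "0 \<le> margin j (Yn j) (\<tau> j) \<omega>"
        unfolding margin_nonneg_iff using Suc[of "\<tau> j"] L by (simp add: V_before)
    qed (use \<tau>(1)[of j] \<sigma>_bounds[of j \<omega>] False in \<open>auto simp: \<sigma>_def\<close>)
    then show ?thesis unfolding margin_nonneg_iff Yn_Suc .
  qed
qed

text \<open>Outside \<open>E j\<close> the noise is at most half the gap between the barriers, so
  the lower one is out of reach, while the drift brings \<open>V\<close> to 1 by the end of the
  block. The exit therefore takes place at 1.\<close>

lemma Yn_success:
  assumes \<omega>: "\<omega> \<in> space M" "\<omega> \<notin> E j"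
  shows "Yn (Suc j) (\<tau> (Suc j)) \<omega> = 1"
proof -
  have V_lower: "L j - \<epsilon> / 2 ^ (j + 2) + g (z j) * (t - \<tau> j) \<le> V j (Yn j) t \<omega>" if "t \<in> {\<tau> j..\<tau> (Suc j)}" for t
    using noise[OF \<omega> that] Yn_bounds[OF \<omega>(1), of j t] that unfolding V_def by (auto simp: min_def)
  have gt: "L (Suc j) < V j (Yn j) t \<omega>" if "t \<in> {\<tau> j..\<tau> (Suc j)}" for t
  proof -
    have "0 \<le> g (z j) * (t - \<tau> j)" using that g_nonneg by auto
    moreover have "0 < \<epsilon> / 2 ^ (j + 2)" using \<epsilon> by simp
    ultimately show ?thesis using V_lower[OF that] L_Suc[of j] by linarith
  qed
  have "1 \<le> V j (Yn j) (\<tau> (Suc j)) \<omega>"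
  proof -
    \<comment> \<open>A starting level of at least \<open>y - \<epsilon>\<close>, a loss of at most
      \<epsilon> through noise and the drift \<open>1 - y + 2 * \<epsilon>\<close> add up to at
      least 1.\<close>
    have "\<epsilon> / 2 ^ (j + 2) \<le> \<epsilon> / 1" using \<epsilon> by (intro divide_left_mono one_le_power) simp_all
    moreover have "y - \<epsilon> \<le> L j" using \<epsilon> by (simp add: L_def)
    ultimately show ?thesis
      using V_lower[of "\<tau> (Suc j)"] \<tau>(1)[of j] drift[of j] by (simp only: atLeastAtMost_iff) linarith
  qed
  then have "margin j (Yn j) (\<tau> (Suc j)) \<omega> \<le> 0" by (simp add: margin_def)
  then have "margin j (Yn j) (\<sigma> j \<omega>) \<omega> \<le> 0"
    using hitting_closed[where X="margin j (Yn j)", OF margin_continuous[OF \<omega>(1)]] \<tau>(1)[of j]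
    unfolding \<sigma>_def by (metis less_imp_le)
  then have "1 \<le> V j (Yn j) (\<sigma> j \<omega>) \<omega>"
    using gt[of "\<sigma> j \<omega>"] \<sigma>_bounds[of j \<omega>] by (auto simp: margin_def min_le_iff_disj)
  moreover have "Yn (Suc j) (\<tau> (Suc j)) \<omega> = V j (Yn j) (\<sigma> j \<omega>) \<omega>"
    using \<sigma>_bounds[of j \<omega>] by (simp add: Yn_Suc min_def)
  ultimately show ?thesis using Yn_bounds[OF \<omega>(1), of "Suc j" "\<tau> (Suc j)"] by simp
qed

text \<open>A block that starts at level 1 has zero margin and stops at once, so nothing changes any
  more.\<close>

lemma after_success:
  assumes \<omega>: "\<omega> \<in> space M" "\<omega> \<notin> E j" and "Suc j \<le> i"
  shows "\<sigma> i \<omega> = \<tau> i \<and> (\<forall>t. Yn i t \<omega> = Yn (Suc j) t \<omega>)"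
proof -
  have step: "\<sigma> i \<omega> = \<tau> i" if "\<forall>t. Yn i t \<omega> = Yn (Suc j) t \<omega>" "Suc j \<le> i" for i
  proof (rule antisym[OF _ \<sigma>_bounds(1)], rule ccontr)
    assume "\<not> \<sigma> i \<omega> \<le> \<tau> i"
    then have "0 < margin i (Yn i) (\<tau> i) \<omega>"
      using before_hitting[of "\<tau> i" "\<tau> i" "margin i (Yn i)" "\<tau> (Suc i)" \<omega>] \<tau>(1)[of i]
      unfolding \<sigma>_def by simp
    then have "Yn i (\<tau> i) \<omega> < 1" by (simp add: margin_def V_before)
    moreover have "Yn i (\<tau> i) \<omega> = 1"
      using Yn_success[OF \<omega>] Yn_stopped[of "Suc j" "\<tau> i" \<omega>] \<tau>_mono[OF that(2)] that(1)
      by (simp add: min_def split: if_splits)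
    ultimately show False by simp
  qed
  have "\<forall>t. Yn i t \<omega> = Yn (Suc j) t \<omega>" using \<open>Suc j \<le> i\<close>
  proof (induction i rule: dec_induct)
    case (step i)
    then show ?case using \<open>\<And>i. _ \<Longrightarrow> _ \<Longrightarrow> \<sigma> i \<omega> = \<tau> i\<close>[of i] by (simp add: Yn_increment)
  qed simp
  then show ?thesis using step[of i] \<open>Suc j \<le> i\<close> by simp
qed

section \<open>The limit process as a bounded solution\<close>

definition failure :: "'w set" where
  "failure = (\<Inter>j. E j)"

text \<open>Failure of all blocks is at most as likely as failure of any single one, and these
  probabilities tend to 0.\<close>

lemma failure: "failure \<in> null_sets M"
proof -
  have "emeasure M failure \<le> ennreal ((1 / 2) ^ j)" for j
    using E by (intro order_trans[OF emeasure_mono E(2)[of j]]) (auto simp: failure_def)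
  moreover have "(\<lambda>j. ennreal ((1 / 2) ^ j)) \<longlonglongrightarrow> ennreal 0"
    by (intro tendsto_ennrealI LIMSEQ_power_zero) simp
  ultimately have "emeasure M failure \<le> ennreal 0" by (intro LIMSEQ_le_const) auto
  moreover have "failure \<in> sets M" unfolding failure_def using E(1) by auto
  ultimately show ?thesis by (auto simp: null_sets_def)
qed

sublocale blocks: brownian_blocks M T B \<tau> \<sigma> z
proof
  show "AE \<omega> in M. \<exists>J. \<forall>j\<ge>J. \<sigma> j \<omega> = \<tau> j"
    using AE_not_in[OF failure] AE_space
  proof eventually_elim
    case (elim \<omega>)
    then obtain j where "\<omega> \<notin> E j" by (auto simp: failure_def)
    then show ?case using after_success[OF elim(2)] by blast
  qed
qed (use \<tau>_range stopping_\<sigma> \<sigma>_bounds in auto)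

text \<open>Off \<open>failure\<close> the sequence is eventually constant. The value
  \<open>y\<close> on \<open>failure\<close> makes bounds and continuity hold on every path.\<close>

definition Y :: "real \<Rightarrow> 'w \<Rightarrow> real" where
  "Y t \<omega> = (if \<omega> \<in> failure then y else lim (\<lambda>n. Yn n t \<omega>))"

lemma Y_eq:
  assumes "\<omega> \<in> space M" "\<omega> \<notin> E j"
  shows "Y t \<omega> = Yn (Suc j) t \<omega>" and "(\<lambda>n. Yn n t \<omega>) \<longlonglongrightarrow> Y t \<omega>"
proof -
  have "\<forall>n\<ge>Suc j. Yn n t \<omega> = Yn (Suc j) t \<omega>" using after_success[OF assms] by blast
  then have "\<forall>\<^sub>F n in sequentially. Yn n t \<omega> = Yn (Suc j) t \<omega>"
    unfolding eventually_sequentially by (rule exI)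
  then have *: "(\<lambda>n. Yn n t \<omega>) \<longlonglongrightarrow> Yn (Suc j) t \<omega>" by (rule tendsto_eventually)
  then show "Y t \<omega> = Yn (Suc j) t \<omega>"
    using assms by (auto simp: Y_def failure_def dest: limI)
  with * show "(\<lambda>n. Yn n t \<omega>) \<longlonglongrightarrow> Y t \<omega>" by simp
qed

lemma continuous_adapted_Y: "continuous_adapted Y"
  unfolding continuous_adapted_def
proof (intro conjI ballI)
  fix t assume t: "t \<in> {0..T}"
  show "Y t \<in> borel_measurable (F t)"
  proof (rule borel_measurable_LIMSEQ_metric)
    show "(\<lambda>\<omega>. if \<omega> \<in> failure then y else Yn n t \<omega>) \<in> borel_measurable (F t)" for n
      using continuous_adapted_Yn t unfolding continuous_adapted_def by (intro measurable_If_null failure) auto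
    fix \<omega> assume "\<omega> \<in> space (F t)"
    then have \<omega>: "\<omega> \<in> space M" by simp
    show "(\<lambda>n. if \<omega> \<in> failure then y else Yn n t \<omega>) \<longlonglongrightarrow> Y t \<omega>"
    proof (cases "\<omega> \<in> failure")
      case False
      then obtain j where "\<omega> \<notin> E j" by (auto simp: failure_def)
      from Y_eq(2)[OF \<omega> this] False show ?thesis by simp
    qed (simp add: Y_def)
  qed
next
  fix \<omega> assume \<omega>: "\<omega> \<in> space M"
  show "continuous_on {0..T} (\<lambda>t. Y t \<omega>)"
  proof (cases "\<omega> \<in> failure")
    case True
    then show ?thesis by (simp add: Y_def)
  next
    case False
    then obtain j where "\<omega> \<notin> E j" by (auto simp: failure_def)
    then show ?thesis
      using continuous_adapted_paths[OF continuous_adapted_Yn \<omega>] Y_eq(1)[OF \<omega>] by simp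
  qed
qed

lemma Y_bounds:
  assumes "\<omega> \<in> space M"
  shows "y - \<epsilon> \<le> Y t \<omega>" "Y t \<omega> \<le> 1"
proof -
  have "y - \<epsilon> \<le> Y t \<omega> \<and> Y t \<omega> \<le> 1"
  proof (cases "\<omega> \<in> failure")
    case True
    then show ?thesis using y \<epsilon> by (simp add: Y_def)
  next
    case False
    then obtain j where j: "\<omega> \<notin> E j" by (auto simp: failure_def)
    have "y - \<epsilon> \<le> L (Suc j)" using \<epsilon> by (simp add: L_def)
    then show ?thesis using Yn_bounds[OF assms, of "Suc j" t] Y_eq(1)[OF assms j] by simp
  qed
  then show "y - \<epsilon> \<le> Y t \<omega>" "Y t \<omega> \<le> 1" by auto
qed

lemma Y_before:
  assumes "\<omega> \<in> space M" "t \<le> \<tau> 0"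
  shows "Y t \<omega> = y"
proof (cases "\<omega> \<in> failure")
  case False
  then obtain j where j: "\<omega> \<notin> E j" by (auto simp: failure_def)
  have "min t (\<sigma> i \<omega>) = min t (\<tau> i)" for i
    using \<sigma>_bounds(1)[of i \<omega>] \<tau>_mono[of 0 i] assms(2) by (simp add: min_def)
  then show ?thesis using Y_eq(1)[OF assms(1) j] by (simp add: Yn_sum)
qed (simp add: Y_def)

lemma Y_after:
  assumes "\<omega> \<in> space M" "\<omega> \<notin> failure" "e \<le> t"
  shows "Y t \<omega> = 1"
proof -
  obtain j where j: "\<omega> \<notin> E j" using assms by (auto simp: failure_def)
  have "min t (\<tau> (Suc j)) = \<tau> (Suc j)" using \<tau>(3)[of "Suc j"] assms(3) by simp
  then show ?thesis
    using Yn_stopped[of "Suc j" t \<omega>] Yn_success[OF assms(1) j] Y_eq(1)[OF assms(1) j] by simp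
qed

text \<open>The blocks are disjoint, so at most one summand of \<open>blocks.Z\<close> is nonzero at
  a given time; together with \<open>g 0 = 0\<close> this lets the nonlinear \<open>g\<close> pass
  through the sum.\<close>

lemma g_Z:
  assumes J: "\<forall>j\<ge>J. \<sigma> j \<omega> = \<tau> j"
  shows "g (blocks.Z s \<omega>) = (\<Sum>j<J. g (z j) * indicator {\<tau> j<..\<sigma> j \<omega>} s)"
proof (cases "\<exists>j<J. s \<in> {\<tau> j<..\<sigma> j \<omega>}")
  case True
  then obtain k where k: "k < J" "s \<in> {\<tau> k<..\<sigma> k \<omega>}" by blast
  have unique: "j = k" if "s \<in> {\<tau> j<..\<sigma> j \<omega>}" for j
  proof (rule ccontr)
    assume "j \<noteq> k"
    then consider "Suc j \<le> k" | "Suc k \<le> j" by linarith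
    then show False
      using that k \<sigma>_bounds(2)[of j \<omega>] \<sigma>_bounds(2)[of k \<omega>] \<tau>_mono[of "Suc j" k] \<tau>_mono[of "Suc k" j]
      by cases auto
  qed
  have ind: "indicator {\<tau> j<..\<sigma> j \<omega>} s = (if j = k then 1 else 0 :: real)" for j
  proof (cases "j = k")
    case True
    then show ?thesis using k(2) by (simp only: indicator_simps if_True simp_thms)
  next
    case False
    then have "s \<notin> {\<tau> j<..\<sigma> j \<omega>}" using unique by blast
    then show ?thesis using False by (simp only: indicator_simps if_False simp_thms)
  qed
  show ?thesis unfolding blocks.Z_finite[OF J] ind using k(1)
    by (simp add: if_distrib[of "\<lambda>x. x *\<^sub>R _"] if_distrib[of "\<lambda>x. _ * x"] cong: if_cong)
next
  case False
  then have "indicator {\<tau> j<..\<sigma> j \<omega>} s = (0 :: real)" if "j < J" for j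
    using that by (auto simp: indicator_def)
  then show ?thesis unfolding blocks.Z_finite[OF J] by (simp add: g_zero)
qed

text \<open>Subtracting the forward representation \<open>Yn_sum\<close> at \<open>t\<close> from
  the one at \<open>T\<close>, where the value is 1, yields the backward equation.\<close>

lemma Y_equation:
  assumes \<omega>: "\<omega> \<in> space M" "\<omega> \<notin> failure" and t: "t \<in> {0..T}"
  shows "Y t \<omega> = 1 - (LINT s:{t..T}|lborel. g (blocks.Z s \<omega>)) + (blocks.I T \<omega> - blocks.I t \<omega>)"
proof -
  obtain j where j: "\<omega> \<notin> E j" using \<omega> by (auto simp: failure_def)
  define J where "J = Suc j"
  have J: "\<forall>i\<ge>J. \<sigma> i \<omega> = \<tau> i" using after_success[OF \<omega>(1) j] unfolding J_def by blast
  have \<sigma>T: "\<sigma> i \<omega> \<le> T" for i using \<sigma>_bounds(2)[of i \<omega>] \<tau>_range[of "Suc i"] by auto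
  have "(LINT s:{t..T}|lborel. g (blocks.Z s \<omega>)) =
      (\<Sum>i<J. LINT s:{t..T}|lborel. g (z i) * indicator {\<tau> i<..\<sigma> i \<omega>} s)"
    unfolding g_Z[OF J] set_lebesgue_integral_def scaleR_sum_right
  proof (rule Bochner_Integration.integral_sum)
    fix i
    show "integrable lborel (\<lambda>s. indicator {t..T} s *\<^sub>R (g (z i) * indicator {\<tau> i<..\<sigma> i \<omega>} s))"
      using set_lebesgue_integral_indicator_Ioc(1)[OF \<sigma>_bounds(1)[of i \<omega>] \<sigma>T[of i],
          where c="g (z i)" and t=t] t
      unfolding set_integrable_def by simp
  qed
  also have "\<dots> = (\<Sum>i<J. g (z i) * ((\<sigma> i \<omega> - \<tau> i) - (min t (\<sigma> i \<omega>) - min t (\<tau> i))))"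
    using t \<sigma>T \<sigma>_bounds by (intro sum.cong refl set_lebesgue_integral_indicator_Ioc) auto
  also have "\<dots> = (\<Sum>i<J. g (z i) * (min T (\<sigma> i \<omega>) - min T (\<tau> i)))
      - (\<Sum>i<J. g (z i) * (min t (\<sigma> i \<omega>) - min t (\<tau> i)))"
    using \<sigma>T \<tau>_range by (simp add: sum_subtractf[symmetric] right_diff_distrib min_absorb2)
  finally have int: "(LINT s:{t..T}|lborel. g (blocks.Z s \<omega>)) =
      (\<Sum>i<J. g (z i) * (min T (\<sigma> i \<omega>) - min T (\<tau> i)))
      - (\<Sum>i<J. g (z i) * (min t (\<sigma> i \<omega>) - min t (\<tau> i)))" .
  have "Y T \<omega> = 1" using Y_after[OF \<omega>] \<tau>(4) by simp
  then show ?thesis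
    unfolding int blocks.I_finite[OF J] Y_eq(1)[OF \<omega>(1) j] J_def[symmetric] Yn_sum by simp
qed

text \<open>A block costs at most its full drift, and block \<open>i > 0\<close> is nonempty only if
  block \<open>i - 1\<close> failed. Block 0 is charged on every path, which gives the separate
  first term.\<close>

lemma g_Z_integral_le:
  assumes \<omega>: "\<omega> \<in> space M" "\<omega> \<notin> failure"
  shows "(\<integral>\<^sup>+s\<in>{0..T}. ennreal (g (blocks.Z s \<omega>)) \<partial>lborel)
    \<le> ennreal (1 - y + 2 * \<epsilon>) + (\<Sum>i. ennreal (1 - y + 2 * \<epsilon>) * indicator (E i) \<omega>)"
proof -
  define G where "G = 1 - y + 2 * \<epsilon>"
  obtain j where j: "\<omega> \<notin> E j" using \<omega> by (auto simp: failure_def)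
  define J where "J = Suc j"
  have J: "\<forall>i\<ge>J. \<sigma> i \<omega> = \<tau> i" using after_success[OF \<omega>(1) j] unfolding J_def by blast
  have "(\<integral>\<^sup>+s\<in>{0..T}. ennreal (g (blocks.Z s \<omega>)) \<partial>lborel)
    \<le> (\<integral>\<^sup>+s. (\<Sum>i<J. ennreal (g (z i)) * indicator {\<tau> i<..\<sigma> i \<omega>} s) \<partial>lborel)"
  proof (rule nn_integral_mono)
    fix s
    have "ennreal (g (blocks.Z s \<omega>)) = (\<Sum>i<J. ennreal (g (z i)) * indicator {\<tau> i<..\<sigma> i \<omega>} s)"
      unfolding g_Z[OF J] using g_nonneg
      by (simp add: sum_ennreal[symmetric] ennreal_mult ennreal_indicator del: sum_ennreal)
    then show "ennreal (g (blocks.Z s \<omega>)) * indicator {0..T} s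
        \<le> (\<Sum>i<J. ennreal (g (z i)) * indicator {\<tau> i<..\<sigma> i \<omega>} s)"
      by (simp add: indicator_def)
  qed
  also have "\<dots> = (\<Sum>i<J. ennreal (g (z i)) * ennreal (\<sigma> i \<omega> - \<tau> i))"
    using \<sigma>_bounds by (subst nn_integral_sum) (simp_all add: nn_integral_cmult_indicator del: sum_mult_indicator)
  also have "\<dots> \<le> (\<Sum>i<J. ennreal G * (if i = 0 then 1 else indicator (E (i - 1)) \<omega>))"
  proof (rule sum_mono)
    fix i
    show "ennreal (g (z i)) * ennreal (\<sigma> i \<omega> - \<tau> i) \<le> ennreal G * (if i = 0 then 1 else indicator (E (i - 1)) \<omega>)"
    proof (cases "0 < i \<and> \<omega> \<notin> E (i - 1)")
      case True
      then show ?thesis using after_success[OF \<omega>(1), of "i - 1" i, THEN conjunct1] by simp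
    next
      case False
      have "g (z i) * (\<sigma> i \<omega> - \<tau> i) \<le> g (z i) * (\<tau> (Suc i) - \<tau> i)"
        using \<sigma>_bounds(2)[of i \<omega>] by (intro mult_left_mono g_nonneg) auto
      then have "ennreal (g (z i)) * ennreal (\<sigma> i \<omega> - \<tau> i) \<le> ennreal G"
        using g_nonneg \<sigma>_bounds(1) unfolding drift G_def[symmetric]
        by (simp add: ennreal_mult[symmetric] ennreal_leI)
      then show ?thesis using False by (auto simp: indicator_def)
    qed
  qed
  also have "\<dots> = ennreal G + (\<Sum>i<j. ennreal G * indicator (E i) \<omega>)"
    unfolding J_def by (subst sum.lessThan_Suc_shift) simp
  also have "\<dots> \<le> ennreal G + (\<Sum>i. ennreal G * indicator (E i) \<omega>)"
    by (intro add_left_mono sum_le_suminf summableI) auto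
  finally show ?thesis unfolding G_def .
qed

lemma bounded_bsde_solution_Y: "bounded_bsde_solution M T B g (\<lambda>_. 1) Y"
  unfolding bounded_bsde_solution_def bounded_bsde_solution_pair_def
proof (intro exI[of _ blocks.Z] conjI exI[of _ blocks.I] predictable_continuous_adapted continuous_adapted_Y
    blocks.Z_integrable blocks.ito_integral_I)
  show "bounded_process M T Y"
    unfolding bounded_process_def
  proof (intro exI[of _ "\<bar>y - \<epsilon>\<bar> + 1"] ballI)
    fix t \<omega> assume "\<omega> \<in> space M"
    from Y_bounds[OF this, of t] show "\<bar>Y t \<omega>\<bar> \<le> \<bar>y - \<epsilon>\<bar> + 1" by linarith
  qed
  define G where "G = 1 - y + 2 * \<epsilon>"
  have "(\<integral>\<^sup>+\<omega>. (\<integral>\<^sup>+s\<in>{0..T}. ennreal (g (blocks.Z s \<omega>)) \<partial>lborel) \<partial>M)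
    \<le> (\<integral>\<^sup>+\<omega>. ennreal G + (\<Sum>i. ennreal G * indicator (E i) \<omega>) \<partial>M)"
  proof (rule nn_integral_mono_AE)
    show "AE \<omega> in M. (\<integral>\<^sup>+s\<in>{0..T}. ennreal (g (blocks.Z s \<omega>)) \<partial>lborel)
      \<le> ennreal G + (\<Sum>i. ennreal G * indicator (E i) \<omega>)"
      using AE_not_in[OF failure] AE_space
      by eventually_elim (unfold G_def, rule g_Z_integral_le)
  qed
  also have "\<dots> = ennreal G + (\<Sum>i. ennreal G * emeasure M (E i))"
    using E(1) by (subst nn_integral_add, measurable, subst nn_integral_suminf, measurable)
      (simp add: nn_integral_cmult emeasure_space_1)
  also have "\<dots> \<le> ennreal G + (\<Sum>i. ennreal (G * (1 / 2) ^ i))"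
    using y \<epsilon> by (intro add_left_mono suminf_le summableI)
      (auto simp: G_def ennreal_mult intro!: mult_left_mono E(2))
  also have "(\<Sum>i. ennreal (G * (1 / 2) ^ i)) = ennreal (G * (1 / (1 - 1 / 2)))"
    using y \<epsilon> by (intro suminf_ennreal_eq sums_mult geometric_sums) (auto simp: G_def)
  also have "ennreal G + \<dots> < \<infinity>" by (simp add: ennreal_add_eq_top less_top)
  finally show "(\<integral>\<^sup>+\<omega>. (\<integral>\<^sup>+s\<in>{0..T}. ennreal (g (blocks.Z s \<omega>)) \<partial>lborel) \<partial>M) < \<infinity>" .
  show "AE \<omega> in M. \<forall>t\<in>{0..T}. Y t \<omega> =
      1 - (LINT s:{t..T}|lborel. g (blocks.Z s \<omega>)) + (blocks.I T \<omega> - blocks.I t \<omega>)"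
    using AE_not_in[OF failure] AE_space by eventually_elim (auto intro: Y_equation)
qed

end

section \<open>Failure of monotone stability\<close>

context brownian_space
begin

text \<open>All that remains is to choose the vectors \<open>z j\<close>: the larger
  \<open>g (z j)\<close> is, absolutely and relative to the squared norm, the shorter and the less
  noisy the block.\<close>

lemma upward_jump_exists:
  assumes g: "\<And>x. 0 \<le> g x" "g 0 = 0" "\<And>K. \<exists>z. K \<le> g z \<and> K * (norm z)\<^sup>2 \<le> g z"
    and ab: "0 \<le> a" "a < b" "b \<le> T" and y: "y < 1" and \<epsilon>: "0 < \<epsilon>"
  shows "\<exists>Y. bounded_bsde_solution M T B g (\<lambda>_. 1) Y \<and>
    (\<forall>\<omega>\<in>space M. \<forall>t. y - \<epsilon> \<le> Y t \<omega> \<and> Y t \<omega> \<le> 1) \<and>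
    (\<forall>\<omega>\<in>space M. \<forall>t\<le>a. Y t \<omega> = y) \<and> (AE \<omega> in M. \<forall>t\<ge>b. Y t \<omega> = 1)"
proof -
  obtain C where C: "0 \<le> C" "\<And>s \<Delta> \<eta> z. 0 \<le> s \<Longrightarrow> 0 \<le> \<Delta> \<Longrightarrow> s + \<Delta> \<le> T \<Longrightarrow> 0 < \<eta> \<Longrightarrow>
    \<exists>E\<in>sets M. emeasure M E \<le> ennreal (C * ((norm z)\<^sup>2 * \<Delta>)\<^sup>2 / \<eta> ^ 4) \<and>
      (\<forall>\<omega>\<in>space M - E. \<forall>t\<in>{s..s + \<Delta>}. \<bar>z \<bullet> (W t \<omega> - W s \<omega>)\<bar> \<le> \<eta>)"
    using W_maximal_inequality by blast
  define G where "G = 1 - y + 2 * \<epsilon>"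
  have G: "0 < G" using y \<epsilon> by (simp add: G_def)
  define \<eta> where "\<eta> j = \<epsilon> / 2 ^ (j + 2)" for j :: nat
  have \<eta>: "0 < \<eta> j" for j using \<epsilon> by (simp add: \<eta>_def)
  \<comment> \<open>The maximal inequality gives probability at most \<open>(1 / 2) ^ j\<close> once
    \<open>C * ((norm z)\<^sup>2 * \<Delta>)\<^sup>2\<close> is at most \<open>c j\<close>.\<close>
  define c where "c j = \<eta> j ^ 4 * (1 / 2) ^ j" for j
  have c: "0 < c j" for j using \<eta>[of j] by (simp add: c_def)
  \<comment> \<open>The bound 1 makes \<open>g (z j)\<close> positive and later allows a square to
    be dropped; the second bound fits block \<open>j\<close> into a fraction
    \<open>1 / 2 ^ Suc j\<close> of the interval; the third makes its noise small.\<close>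
  define \<kappa> where "\<kappa> j = max 1 (max (G * 2 ^ Suc j / (b - a)) (C * G\<^sup>2 / c j))" for j
  have "\<exists>z. \<forall>j. \<kappa> j \<le> g (z j) \<and> \<kappa> j * (norm (z j))\<^sup>2 \<le> g (z j)"
    using g(3) by (intro choice) blast
  then obtain z where z: "\<And>j. \<kappa> j \<le> g (z j)" "\<And>j. \<kappa> j * (norm (z j))\<^sup>2 \<le> g (z j)" by blast
  have \<kappa>: "1 \<le> \<kappa> j" "G * 2 ^ Suc j / (b - a) \<le> \<kappa> j" "C * G\<^sup>2 / c j \<le> \<kappa> j" for j
    by (auto simp: \<kappa>_def)
  have gz: "0 < g (z j)" for j using z(1)[of j] \<kappa>(1)[of j] by linarith
  \<comment> \<open>The length at which the drift of the block is exactly \<open>G\<close>.\<close>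
  define \<Delta> where "\<Delta> j = G / g (z j)" for j
  define \<tau> where "\<tau> j = a + (\<Sum>i<j. \<Delta> i)" for j
  have \<Delta>: "0 < \<Delta> j" "\<Delta> j \<le> (b - a) / 2 ^ Suc j" for j
  proof -
    show "0 < \<Delta> j" using G gz by (simp add: \<Delta>_def)
    have "G * 2 ^ Suc j / (b - a) \<le> g (z j)" using \<kappa>(2) z(1) by (rule order_trans)
    then have "G * 2 ^ Suc j \<le> g (z j) * (b - a)" using ab by (simp only: pos_divide_le_eq diff_gt_0_iff_gt)
    then show "\<Delta> j \<le> (b - a) / 2 ^ Suc j" using gz[of j] by (simp add: \<Delta>_def field_simps)
  qed
  have \<tau>_le: "\<tau> j \<le> b" for j
  proof -
    have "(\<Sum>i<j. \<Delta> i) \<le> (\<Sum>i<j. (b - a) / 2 ^ Suc i)" by (intro sum_mono \<Delta>)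
    also have "\<dots> = (b - a) * (1 - 1 / 2 ^ j)"
      by (induction j) (simp_all add: field_simps)
    also have "\<dots> \<le> (b - a) * 1" using ab by (intro mult_left_mono) auto
    finally show ?thesis by (simp add: \<tau>_def)
  qed
  have \<tau>_Suc: "\<tau> (Suc j) = \<tau> j + \<Delta> j" for j by (simp add: \<tau>_def)
  have \<tau>_nonneg: "0 \<le> \<tau> j" for j
    unfolding \<tau>_def using ab(1) \<Delta>(1) by (intro add_nonneg_nonneg sum_nonneg) (auto intro: less_imp_le)
  have small: "C * ((norm (z j))\<^sup>2 * \<Delta> j)\<^sup>2 / \<eta> j ^ 4 \<le> (1 / 2) ^ j" for j
  proof -
    have "(norm (z j))\<^sup>2 * \<Delta> j \<le> G / \<kappa> j"
    proof -
      have "G * (\<kappa> j * (norm (z j))\<^sup>2) \<le> G * g (z j)" using G by (intro mult_left_mono z) auto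
      then show ?thesis using gz[of j] \<kappa>(1)[of j] unfolding \<Delta>_def
        by (simp add: field_simps)
    qed
    then have "((norm (z j))\<^sup>2 * \<Delta> j)\<^sup>2 \<le> (G / \<kappa> j)\<^sup>2"
      using \<Delta>(1)[of j] by (intro power_mono) auto
    \<comment> \<open>Since \<open>\<kappa> j\<close> is at least 1, one power of it
      suffices.\<close>
    also have "\<dots> \<le> G\<^sup>2 / \<kappa> j"
      using \<kappa>(1)[of j] G by (simp add: power_divide divide_left_mono power2_eq_square)
    finally have "C * ((norm (z j))\<^sup>2 * \<Delta> j)\<^sup>2 \<le> C * (G\<^sup>2 / \<kappa> j)"
      using C(1) by (rule mult_left_mono)
    also have "\<dots> \<le> c j"
      using \<kappa>(1)[of j] \<kappa>(3)[of j] c[of j] by (simp add: field_simps)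
    finally show ?thesis using \<eta>[of j] unfolding c_def by (simp add: pos_divide_le_eq mult.commute)
  qed
  have "\<exists>E\<in>sets M. emeasure M E \<le> ennreal ((1 / 2) ^ j) \<and>
      (\<forall>\<omega>\<in>space M - E. \<forall>t\<in>{\<tau> j..\<tau> (Suc j)}. \<bar>z j \<bullet> (W t \<omega> - W (\<tau> j) \<omega>)\<bar> \<le> \<eta> j)" for j
  proof -
    have "\<tau> j + \<Delta> j \<le> T" using \<tau>_le[of "Suc j"] ab unfolding \<tau>_Suc by simp
    from C(2)[of "\<tau> j" "\<Delta> j" "\<eta> j" "z j", OF \<tau>_nonneg less_imp_le[OF \<Delta>(1)] this \<eta>]
    show ?thesis unfolding \<tau>_Suc using order_trans[OF _ ennreal_leI[OF small[of j]]] by blast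
  qed
  then have "\<exists>E. \<forall>j. E j \<in> sets M \<and> emeasure M (E j) \<le> ennreal ((1 / 2) ^ j) \<and>
      (\<forall>\<omega>\<in>space M - E j. \<forall>t\<in>{\<tau> j..\<tau> (Suc j)}. \<bar>z j \<bullet> (W t \<omega> - W (\<tau> j) \<omega>)\<bar> \<le> \<eta> j)"
    by (intro choice) blast
  then obtain E where E: "\<And>j. E j \<in> sets M" "\<And>j. emeasure M (E j) \<le> ennreal ((1 / 2) ^ j)"
      "\<And>j \<omega> t. \<omega> \<in> space M \<Longrightarrow> \<omega> \<notin> E j \<Longrightarrow> t \<in> {\<tau> j..\<tau> (Suc j)} \<Longrightarrow>
        \<bar>z j \<bullet> (W t \<omega> - W (\<tau> j) \<omega>)\<bar> \<le> \<eta> j"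
    by blast
  interpret upward_jump M T B g y \<epsilon> b \<tau> z E
  proof
    show "g (z j) * (\<tau> (Suc j) - \<tau> j) = 1 - y + 2 * \<epsilon>" for j
      using gz[of j] by (simp add: \<tau>_Suc \<Delta>_def G_def)
    show "\<tau> j < \<tau> (Suc j)" for j using \<Delta>(1) by (simp add: \<tau>_Suc)
    show "\<bar>z j \<bullet> (W t \<omega> - W (\<tau> j) \<omega>)\<bar> \<le> \<epsilon> / 2 ^ (j + 2)"
      if "\<omega> \<in> space M" "\<omega> \<notin> E j" "t \<in> {\<tau> j..\<tau> (Suc j)}" for j \<omega> t
      using E(3)[OF that] unfolding \<eta>_def .
  qed (use g y \<epsilon> \<tau>_nonneg \<tau>_le ab E in auto)
  have "\<tau> 0 = a" by (simp add: \<tau>_def)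
  moreover have "AE \<omega> in M. \<forall>t\<ge>b. Y t \<omega> = 1"
    using AE_not_in[OF failure] AE_space by eventually_elim (auto intro: Y_after)
  ultimately show ?thesis
    using bounded_bsde_solution_Y Y_bounds Y_before by (intro exI[of _ Y]) auto
qed

text \<open>The finite expectation and Tonelli's theorem make \<open>g (Z s \<omega>)\<close>
  integrable in time on almost every path, so the drift term is continuous in its lower limit; the
  stochastic integral is continuous by definition. Continuity of \<open>g\<close> provides the
  measurability of \<open>g\<close> along \<open>Z\<close>.\<close>

lemma bsde_solution_continuous:
  assumes sol: "bounded_bsde_solution M T B g \<xi> Y"
    and g: "continuous_on UNIV g" "\<And>x. 0 \<le> g x"
  shows "AE \<omega> in M. continuous_on {0..T} (\<lambda>t. Y t \<omega>)"
proof -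
  from sol obtain Z I where Z: "predictable M T F Z"
    and int: "(\<integral>\<^sup>+\<omega>. (\<integral>\<^sup>+s\<in>{0..T}. ennreal (g (Z s \<omega>)) \<partial>lborel) \<partial>M) < \<infinity>"
    and I: "AE \<omega> in M. continuous_on {0..T} (\<lambda>t. I t \<omega>)"
    and eq: "AE \<omega> in M. \<forall>t\<in>{0..T}.
       Y t \<omega> = \<xi> \<omega> - (LINT s:{t..T}|lborel. g (Z s \<omega>)) + (I T \<omega> - I t \<omega>)"
    unfolding bounded_bsde_solution_def bounded_bsde_solution_pair_def brownian_integrable_def
      ito_integral_def by blast
  define h where "h x = indicator {0..T} (fst x) *\<^sub>R g (Z (fst x) (snd x))" for x
  have "(\<lambda>x. g (case x of (t, \<omega>) \<Rightarrow> Z t \<omega>)) \<in> borel_measurable Pred"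
    using Z unfolding predictable_def
    by (rule measurable_compose[OF _ borel_measurable_continuous_onI[OF g(1)]])
  then have h: "h \<in> borel_measurable (borel \<Otimes>\<^sub>M M)"
    unfolding h_def[abs_def] case_prod_unfold by (rule measurable_predictable_pair)
  have measurable_path: "(\<lambda>s. h (s, \<omega>)) \<in> borel_measurable lborel" if "\<omega> \<in> space M" for \<omega>
    using measurable_compose[OF measurable_Pair2'[OF that] h] by simp
  have "h \<in> borel_measurable (lborel \<Otimes>\<^sub>M M)"
    using h by (simp cong: measurable_cong_sets sets_pair_measure_cong)
  then have "(\<lambda>x. h (case x of (\<omega>, s) \<Rightarrow> (s, \<omega>))) \<in> borel_measurable (M \<Otimes>\<^sub>M lborel)"
    by (rule measurable_compose[OF measurable_pair_swap'])
  then have "(\<lambda>x. ennreal (h (case x of (\<omega>, s) \<Rightarrow> (s, \<omega>)))) \<in> borel_measurable (M \<Otimes>\<^sub>M lborel)"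
    by (rule measurable_compose[OF _ measurable_ennreal])
  then have "(\<lambda>(\<omega>, s). ennreal (h (s, \<omega>))) \<in> borel_measurable (M \<Otimes>\<^sub>M lborel)"
    by (simp add: case_prod_unfold)
  then have meas: "(\<lambda>\<omega>. \<integral>\<^sup>+s. ennreal (h (s, \<omega>)) \<partial>lborel) \<in> borel_measurable M"
    by (rule lborel.borel_measurable_nn_integral)
  have h_eq: "(\<integral>\<^sup>+s\<in>{0..T}. ennreal (g (Z s \<omega>)) \<partial>lborel) = (\<integral>\<^sup>+s. ennreal (h (s, \<omega>)) \<partial>lborel)" for \<omega>
    by (intro nn_integral_cong) (simp add: h_def indicator_def)
  have "AE \<omega> in M. (\<integral>\<^sup>+s. ennreal (h (s, \<omega>)) \<partial>lborel) \<noteq> \<infinity>"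
    using int unfolding h_eq by (intro nn_integral_PInf_AE[OF meas]) auto
  then show ?thesis using I eq AE_space
  proof eventually_elim
    case (elim \<omega>)
    have "integrable lborel (\<lambda>s. h (s, \<omega>))"
      using elim(1) g(2) measurable_path[OF elim(4)]
      by (intro integrableI_nonneg) (auto simp: h_def less_top)
    then have si: "set_integrable lborel {0..T} (\<lambda>s. g (Z s \<omega>))"
      unfolding set_integrable_def h_def by simp
    have "(LINT s:{t..T}|lborel. g (Z s \<omega>)) = integral {t..T} (\<lambda>s. g (Z s \<omega>))" if "t \<in> {0..T}" for t
      using that by (intro set_borel_integral_eq_integral(2) set_integrable_subset[OF si]) auto
    then have Y: "Y t \<omega> = \<xi> \<omega> - integral {t..T} (\<lambda>s. g (Z s \<omega>)) + (I T \<omega> - I t \<omega>)" if "t \<in> {0..T}" for t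
      using elim(3) that by simp
    have "continuous_on {0..T} (\<lambda>t. \<xi> \<omega> - integral {t..T} (\<lambda>s. g (Z s \<omega>)) + (I T \<omega> - I t \<omega>))"
      by (intro continuous_intros indefinite_integral_continuous_1' elim(2)
          set_borel_integral_eq_integral(1)[OF si])
    then show ?case by (rule continuous_on_eq) (simp only: Y)
  qed
qed

end

text \<open>Otherwise the quotient would be bounded outside the unit ball. There the squared norm is
  at least 1, so one large quotient yields both inequalities.\<close>

lemma superquadratic_values:
  fixes g :: "'a::real_normed_vector \<Rightarrow> real"
  assumes "Limsup at_infinity (\<lambda>z. ereal (g z / (norm z)\<^sup>2)) = \<infinity>"
  shows "\<exists>z. K \<le> g z \<and> K * (norm z)\<^sup>2 \<le> g z"
proof (rule ccontr)
  assume no: "\<nexists>z. K \<le> g z \<and> K * (norm z)\<^sup>2 \<le> g z"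
  \<comment> \<open>The maximum with 1 ensures \<open>c \<le> c * (norm z)\<^sup>2\<close> for
    \<open>norm z\<close> at least 1, whatever the sign of \<open>K\<close>.\<close>
  define c where "c = max K 1"
  have c: "K \<le> c" "1 \<le> c" by (simp_all add: c_def)
  have "g z / (norm z)\<^sup>2 \<le> c" if "1 \<le> norm z" for z
  proof (rule ccontr)
    assume "\<not> g z / (norm z)\<^sup>2 \<le> c"
    moreover have "0 < (norm z)\<^sup>2" using that by (intro zero_less_power) linarith
    ultimately have *: "c * (norm z)\<^sup>2 < g z"
      by (simp add: not_le pos_less_divide_eq)
    have "K * (norm z)\<^sup>2 \<le> c * (norm z)\<^sup>2" using c by (intro mult_right_mono) auto
    moreover have "K \<le> c * (norm z)\<^sup>2"
      using c mult_left_mono[of 1 "(norm z)\<^sup>2" c] one_le_power[OF that, of 2] by linarith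
    ultimately show False using no * by (meson less_imp_le order_trans)
  qed
  then have "\<forall>\<^sub>F z in at_infinity. ereal (g z / (norm z)\<^sup>2) \<le> ereal c"
    unfolding eventually_at_infinity by (intro exI[of _ 1]) simp
  then have "Limsup at_infinity (\<lambda>z. ereal (g z / (norm z)\<^sup>2)) \<le> ereal c"
    by (rule Limsup_bounded)
  with assms show False by simp
qed

theorem theorem3p4:
  fixes M :: "'w measure" and T :: real
    and B :: "real \<Rightarrow> 'w \<Rightarrow> real ^ 'd" and g :: "real ^ 'd \<Rightarrow> real"
  assumes "prob_space M" and "T > 0"
    and "standard_brownian_motion M T B"
    and "convex_on UNIV g" and "\<forall>z. g z \<ge> 0" and "g 0 = 0"
    and "Limsup at_infinity (\<lambda>z. ereal (g z / (norm z)\<^sup>2)) = \<infinity>"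
    and "\<forall>x. \<bar>fenchel_legendre g x\<bar> \<noteq> \<infinity>"
  shows "\<exists>(\<xi>s :: nat \<Rightarrow> 'w \<Rightarrow> real) (\<xi> :: 'w \<Rightarrow> real)
          (Ys :: nat \<Rightarrow> real \<Rightarrow> 'w \<Rightarrow> real) (Y :: real \<Rightarrow> 'w \<Rightarrow> real).
    (\<forall>k\<ge>1. \<xi>s k \<in> Linf (brownian_filtration M B T)) \<and>
    \<xi> \<in> Linf (brownian_filtration M B T) \<and>
    (\<lambda>k. esssup M (\<lambda>\<omega>. ereal \<bar>\<xi>s k \<omega> - \<xi> \<omega>\<bar>)) \<longlonglongrightarrow> 0 \<and>
    (\<forall>k\<ge>1. bounded_bsde_solution M T B g (\<xi>s k) (Ys k)) \<and>
    (AE \<omega> in M. \<forall>t\<in>{0..T}. \<forall>k\<ge>1. Ys k t \<omega> \<le> Ys (Suc k) t \<omega>) \<and>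
    (\<exists>C. \<forall>k\<ge>1. \<forall>t\<in>{0..T}. \<forall>\<omega>\<in>space M. \<bar>Ys k t \<omega>\<bar> \<le> C) \<and>
    (AE \<omega> in M. \<forall>t\<in>{0..T}. (\<lambda>k. Ys k t \<omega>) \<longlonglongrightarrow> Y t \<omega>) \<and>
    predictable M T (brownian_filtration M B) Y \<and>
    bounded_process M T Y \<and>
    \<not> bounded_bsde_solution M T B g \<xi> Y"
proof -
  interpret prob_space M by fact
  interpret brownian_space M T B by unfold_locales fact+
  define h where "h = T / 2"
  have h: "0 < h" "h < T" using T_pos by (simp_all add: h_def)
  \<comment> \<open>These times decrease from \<open>T\<close>, the value at \<open>k = 0\<close>,
    to the jump time \<open>h\<close>.\<close>
  define c where "c k = h + h / real (Suc k)" for k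
  have c_less: "c (Suc k) < c k" for k
    using h by (simp add: c_def divide_strict_left_mono)
  have c_range: "h < c k" "c k \<le> T" for k
  proof -
    show "h < c k" using h by (simp add: c_def)
    have "h / real (Suc k) \<le> h / 1" using h by (intro divide_left_mono) auto
    moreover have "T = h + h" by (simp add: h_def)
    ultimately show "c k \<le> T" unfolding c_def by linarith
  qed
  have "(\<lambda>k. h + h / real (Suc k)) \<longlonglongrightarrow> h + 0"
    by (intro tendsto_add tendsto_const divide_Suc_tendsto_zero)
  then have c_lim: "c \<longlonglongrightarrow> h" unfolding c_def[abs_def] by simp
  define v :: "nat \<Rightarrow> real" where "v k = - 1 / real (Suc k)" for k
  have v: "v k < v (Suc k)" "v k < 0" "- 1 \<le> v k" for k
    by (simp_all add: v_def field_simps)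
  have v_lim: "v \<longlonglongrightarrow> 0" unfolding v_def[abs_def] by (rule divide_Suc_tendsto_zero)
  \<comment> \<open>Process \<open>k\<close> rises between \<open>c (Suc k)\<close> and
    \<open>c k\<close> from level \<open>v (Suc k)\<close>. The tolerance
    \<open>v (Suc k) - v k\<close> keeps it above \<open>v k\<close>, which is the starting level of
    process \<open>k - 1\<close>.\<close>
  have "\<exists>Y. bounded_bsde_solution M T B g (\<lambda>_. 1) Y \<and>
    (\<forall>\<omega>\<in>space M. \<forall>t. v k \<le> Y t \<omega> \<and> Y t \<omega> \<le> 1) \<and>
    (\<forall>\<omega>\<in>space M. \<forall>t\<le>c (Suc k). Y t \<omega> = v (Suc k)) \<and> (AE \<omega> in M. \<forall>t\<ge>c k. Y t \<omega> = 1)" for k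
    using upward_jump_exists[of g "c (Suc k)" "c k" "v (Suc k)" "v (Suc k) - v k"] assms(5,6)
      superquadratic_values[OF assms(7)] c_less[of k] c_range(1)[of "Suc k"] c_range(2)[of k] h v[of "Suc k"] v(1)[of k]
    by auto
  then have "\<exists>X. \<forall>k. bounded_bsde_solution M T B g (\<lambda>_. 1) (X k) \<and>
    (\<forall>\<omega>\<in>space M. \<forall>t. v k \<le> X k t \<omega> \<and> X k t \<omega> \<le> 1) \<and>
    (\<forall>\<omega>\<in>space M. \<forall>t\<le>c (Suc k). X k t \<omega> = v (Suc k)) \<and> (AE \<omega> in M. \<forall>t\<ge>c k. X k t \<omega> = 1)"
    by (intro choice) blast
  then obtain X where X: "\<And>k. bounded_bsde_solution M T B g (\<lambda>_. 1) (X k)"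
    "\<And>k t \<omega>. \<omega> \<in> space M \<Longrightarrow> v k \<le> X k t \<omega>" "\<And>k t \<omega>. \<omega> \<in> space M \<Longrightarrow> X k t \<omega> \<le> 1"
    "\<And>k t \<omega>. \<omega> \<in> space M \<Longrightarrow> t \<le> c (Suc k) \<Longrightarrow> X k t \<omega> = v (Suc k)"
    "\<And>k. AE \<omega> in M. \<forall>t\<ge>c k. X k t \<omega> = 1"
    by blast
  have X_after: "AE \<omega> in M. \<forall>k. \<forall>t\<ge>c k. X k t \<omega> = 1"
    using X(5) by (simp add: AE_all_countable)
  define Y :: "real \<Rightarrow> 'w \<Rightarrow> real" where "Y t \<omega> = indicator {h<..T} t" for t \<omega>
  have mono: "AE \<omega> in M. \<forall>t\<in>{0..T}. \<forall>k. X k t \<omega> \<le> X (Suc k) t \<omega>"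
    using X_after AE_space
  proof eventually_elim
    case (elim \<omega>)
    \<comment> \<open>Until \<open>c (Suc k)\<close> process \<open>k\<close> sits at
      \<open>v (Suc k)\<close>, the lower bound of its successor; afterwards the successor is
      already 1, the upper bound of process \<open>k\<close>.\<close>
    have "X k t \<omega> \<le> X (Suc k) t \<omega>" for k t
    proof (cases "t \<le> c (Suc k)")
      case True
      then show ?thesis using X(2)[OF elim(2), of "Suc k" t] X(4)[OF elim(2), of t k] by simp
    next
      case False
      then show ?thesis using X(3)[OF elim(2), of k t] elim(1) by simp
    qed
    then show ?case by blast
  qed
  have lim: "AE \<omega> in M. \<forall>t\<in>{0..T}. (\<lambda>k. X k t \<omega>) \<longlonglongrightarrow> Y t \<omega>"
    using X_after AE_space
  proof eventually_elim
    case (elim \<omega>)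
    show ?case
    proof
      fix t assume t: "t \<in> {0..T}"
      show "(\<lambda>k. X k t \<omega>) \<longlonglongrightarrow> Y t \<omega>"
      proof (cases "h < t")
        case True
        then have "\<forall>\<^sub>F k in sequentially. c k < t" by (rule order_tendstoD(2)[OF c_lim])
        then have "\<forall>\<^sub>F k in sequentially. X k t \<omega> = Y t \<omega>"
          by (rule eventually_mono) (use elim(1) True t in \<open>auto simp: Y_def\<close>)
        then show ?thesis by (rule tendsto_eventually)
      next
        case False
        then have "X k t \<omega> = v (Suc k)" for k
          using c_range(1)[of "Suc k"] by (intro X(4) elim(2)) simp
        then show ?thesis using LIMSEQ_Suc[OF v_lim] False by (simp add: Y_def)
      qed
    qed
  qed
  have pred: "predictable M T F Y"
    unfolding predictable_def Y_def
    using measurable_Pred_if[of "\<lambda>_. 1 :: real" h "{h<..T}"] sets_Pred_block[of _ h T] h by simp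
  have not_sol: "\<not> bounded_bsde_solution M T B g (\<lambda>_. 1) Y"
  proof
    assume "bounded_bsde_solution M T B g (\<lambda>_. 1) Y"
    then have "AE \<omega> in M. continuous_on {0..T} (\<lambda>t. Y t \<omega>)"
      using assms(5) convex_on_continuous[OF open_UNIV assms(4)] by (intro bsde_solution_continuous) auto
    \<comment> \<open>Along the times \<open>c k\<close>, which decrease to \<open>h\<close>, the
      limit process is 1, while its value at \<open>h\<close> is 0.\<close>
    moreover have "\<not> continuous_on {0..T} (\<lambda>t. Y t \<omega>)" for \<omega>
    proof
      assume "continuous_on {0..T} (\<lambda>t. Y t \<omega>)"
      then have "(\<lambda>k. Y (c k) \<omega>) \<longlonglongrightarrow> Y h \<omega>"
        using c_range(2) less_trans[OF h(1) c_range(1)] h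
        by (intro continuous_on_tendsto_compose[OF _ c_lim]) (auto intro!: always_eventually less_imp_le)
      then show False using c_range by (simp add: Y_def LIMSEQ_const_iff)
    qed
    ultimately show False by simp
  qed
  have one: "(\<lambda>_. 1) \<in> Linf (F T)" unfolding Linf_def by (auto simp: image_constant_conv)
  have ess: "esssup M (\<lambda>\<omega>. ereal \<bar>1 - 1\<bar>) = 0"
    by (simp add: esssup_const emeasure_space_1)
  have Suc_ge: "\<exists>j. k = Suc j" if "1 \<le> k" for k :: nat using that by (cases k) auto
  \<comment> \<open>The family \<open>X\<close> is indexed from 0 and the claim from 1, hence the
    shift; solution number \<open>k\<close> starts at \<open>v k\<close>.\<close>
  show ?thesis
  proof (rule exI[of _ "\<lambda>_ _. 1"], rule exI[of _ "\<lambda>_. 1"], rule exI[of _ "\<lambda>k. X (k - 1)"],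
      rule exI[of _ Y], intro conjI)
    show "AE \<omega> in M. \<forall>t\<in>{0..T}. \<forall>k\<ge>1. X (k - 1) t \<omega> \<le> X (Suc k - 1) t \<omega>"
      using mono
    proof eventually_elim
      case (elim \<omega>)
      show ?case
      proof (intro ballI allI impI)
        fix t k assume "t \<in> {0..T}" "1 \<le> (k :: nat)"
        moreover from \<open>1 \<le> k\<close> obtain j where "k = Suc j" using Suc_ge by blast
        ultimately show "X (k - 1) t \<omega> \<le> X (Suc k - 1) t \<omega>" using elim by simp
      qed
    qed
    show "\<exists>C. \<forall>k\<ge>1. \<forall>t\<in>{0..T}. \<forall>\<omega>\<in>space M. \<bar>X (k - 1) t \<omega>\<bar> \<le> C"
    proof (intro exI[of _ 1] allI impI ballI)
      fix k t \<omega> assume "\<omega> \<in> space M"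
      then show "\<bar>X (k - 1) t \<omega>\<bar> \<le> 1"
        using X(2)[of \<omega> "k - 1" t] X(3)[of \<omega> "k - 1" t] v(3)[of "k - 1"] by linarith
    qed
    show "AE \<omega> in M. \<forall>t\<in>{0..T}. (\<lambda>k. X (k - 1) t \<omega>) \<longlonglongrightarrow> Y t \<omega>"
      using lim by eventually_elim (intro ballI, rule LIMSEQ_imp_Suc, simp)
    show "bounded_process M T Y"
      unfolding bounded_process_def by (intro exI[of _ 1]) (simp add: Y_def indicator_def)
  qed (use one ess X(1) pred not_sol in auto)
qed

end
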